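(* For every positive integer $m$, $\sum_{i=1}^n\tilde\theta_i^m=0$ in $\widetilde{FK}_n$.
   Context: Fix $n\ge2$. Let $\mathcal S$ be the set of symbols $[ij]$, $i<j$ integers with $i\not\equiv j\pmod n$; for $i>j$ put $[ij]:=-[ji]$. $\mathcal A$ is the completion of the free algebra on $\mathcal S$ along the filtration by subalgebras generated by $[ij]$ with $|i|,|j|\ge N$. $\widetilde S_n$ is the affine symmetric group with length $\ell$, $t_{ij}$ the reflection swapping $i+rn,j+rn$ for all $r$; $\mathbb A$ is the affine nilCoxeter algebra with basis $A_w$; $[ij]$ acts on the right by $A_w\cdot[ij]=A_{wt_{ij}}$ if $\ell(wt_{ij})=\ell(w)-1$, else $0$; $\mathcal E\subset\mathcal A$ is the subalgebra of elements whose action on each $A_w$ has finitely many nonzero terms. $\widetilde{FK}_n$ is the quotient of $\mathcal E$ by: (a) $[ij]^2=0$; (b) $[ij][kl]=[kl][ij]$ if $i,j,k,l$ have distinct residues; (c) for $i,j,k$ with distinct residues, $[ij][jk]=[jk][ik]+[ik][ij]$ and $[jk][ij]=[ik][jk]+[ik][ij]$; (d) for $i\not\equiv j$, $\sum_{i'\equiv i,\,j'\equiv j}[ij'][ji']=0$; (e) $[i,j]=[i+n,j+n]$. $\tilde\theta_i=\sum_{j\in\mathbb Z,\,j\not\equiv i}[ij]$.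
   Formalization: The completion uses two-sided ideals generated by [ij] with |i| or |j| ≥ N (else θ̃_i is undefined), and E is divided by the ideal of (a)–(e) closed for the filtration by |i−j| (else m=1 fails); proved for (c) as printed and with last term [ij][ik]. *)

theory Defs
  imports "HOL-Algebra.QuotRing" "HOL-Library.Groups_Big_Fun"
begin

section \<open>Residues, reflections and the affine symmetric group\<close>

definition distinct_residues :: "nat \<Rightarrow> int list \<Rightarrow> bool" where
  "distinct_residues n xs \<longleftrightarrow> distinct (map (\<lambda>x. x mod int n) xs)"

definition reflection :: "nat \<Rightarrow> int \<Rightarrow> int \<Rightarrow> int \<Rightarrow> int" where
  "reflection n i j k =
     (if k mod int n = i mod int n then k + (j - i)
      else if k mod int n = j mod int n then k + (i - j)
      else k)"

definition word_product :: "nat \<Rightarrow> nat list \<Rightarrow> int \<Rightarrow> int" where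
  "word_product n ks = foldr (\<lambda>k w. reflection n (int k) (int k + 1) \<circ> w) ks id"

text \<open>The Coxeter group of type affine \<open>A\<close>, in its realization by permutations of the integers:
  the group generated by the simple reflections \<open>s\<^sub>0, \<dots>, s\<^sub>n\<^sub>-\<^sub>1\<close>, where \<open>s\<^sub>k\<close> swaps
  \<open>k + r n\<close> and \<open>k + 1 + r n\<close> for all \<open>r\<close>.\<close>

definition affine_sym :: "nat \<Rightarrow> (int \<Rightarrow> int) set" where
  "affine_sym n = word_product n ` lists {..<n}"

definition aff_length :: "nat \<Rightarrow> (int \<Rightarrow> int) \<Rightarrow> nat" where
  "aff_length n w = (LEAST l. \<exists>ks \<in> lists {..<n}. length ks = l \<and> word_product n ks = w)"


section \<open>The completed free algebra\<close>

text \<open>The letter \<open>(i, j)\<close> stands for the symbol \<open>[ij]\<close> with \<open>i < j\<close>. A formal series is given by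
  its coefficients on words. The coefficient ring is arbitrary.\<close>

type_synonym letter = "int \<times> int"
type_synonym 'k series = "letter list \<Rightarrow> 'k"

definition symbols :: "nat \<Rightarrow> letter set" where
  "symbols n = {(i, j). i < j \<and> distinct_residues n [i, j]}"

definition monomial :: "letter list \<Rightarrow> 'k::comm_ring_1 series" where
  "monomial u = (\<lambda>v. if v = u then 1 else 0)"

definition ser_mult :: "'k::comm_ring_1 series \<Rightarrow> 'k series \<Rightarrow> 'k series" where
  "ser_mult f g = (\<lambda>u. \<Sum>k\<le>length u. f (take k u) * g (drop k u))"

definition free_alg :: "nat \<Rightarrow> 'k::comm_ring_1 series set" where
  "free_alg n = {f. finite {u. f u \<noteq> 0} \<and> {u. f u \<noteq> 0} \<subseteq> lists (symbols n)}"

text \<open>All words of the series contain a letter \<open>[ij]\<close> with \<open>\<bar>i\<bar> \<ge> N\<close> or \<open>\<bar>j\<bar> \<ge> N\<close>.  On the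
  free algebra these are the two-sided ideals generated by such letters. They have to be ideals,
  and one large index has to suffice, for the completion to be an algebra containing
  \<open>\<Sum>\<^sub>j [ij]\<close>.\<close>

definition index_filt :: "nat \<Rightarrow> 'k::comm_ring_1 series set" where
  "index_filt N = {f. \<forall>u. f u \<noteq> 0 \<longrightarrow> (\<exists>(i, j) \<in> set u. int N \<le> \<bar>i\<bar> \<or> int N \<le> \<bar>j\<bar>)}"

text \<open>The completion of the free algebra, realized as its closure among all formal
  series.\<close>

definition completed_alg :: "nat \<Rightarrow> 'k::comm_ring_1 series set" where
  "completed_alg n = {f. {u. f u \<noteq> 0} \<subseteq> lists (symbols n) \<and>
     (\<forall>N. \<exists>p \<in> free_alg n. (\<lambda>u. f u - p u) \<in> index_filt N)}"


section \<open>The action on the affine nilCoxeter algebra\<close>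

text \<open>A letter sends a basis element \<open>A\<^sub>w\<close> to a basis element or to zero: \<open>Some v\<close> stands for
  \<open>A\<^sub>v\<close>, and \<open>None\<close> for \<open>0\<close>. Words act from the right.\<close>

definition act_letter :: "nat \<Rightarrow> (int \<Rightarrow> int) \<Rightarrow> letter \<Rightarrow> (int \<Rightarrow> int) option" where
  "act_letter n w a = (let v = w \<circ> reflection n (fst a) (snd a) in
     if aff_length n w = aff_length n v + 1 then Some v else None)"

fun act_word :: "nat \<Rightarrow> (int \<Rightarrow> int) \<Rightarrow> letter list \<Rightarrow> (int \<Rightarrow> int) option" where
  "act_word n w [] = Some w"
| "act_word n w (a # u) = Option.bind (act_letter n w a) (\<lambda>v. act_word n v u)"

definition finite_action :: "nat \<Rightarrow> 'k::comm_ring_1 series set" where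
  "finite_action n = {f \<in> completed_alg n.
     \<forall>w \<in> affine_sym n. finite {u. f u \<noteq> 0 \<and> act_word n w u \<noteq> None}}"

definition E_alg :: "nat \<Rightarrow> 'k::comm_ring_1 series ring" where
  "E_alg n = \<lparr>carrier = finite_action n, mult = ser_mult, one = monomial [],
     zero = (\<lambda>_. 0), add = (\<lambda>f g u. f u + g u)\<rparr>"


section \<open>The affine Fomin--Kirillov algebra\<close>

text \<open>The element \<open>[ij]\<close>, with \<open>[ij] = - [ji]\<close> for \<open>i > j\<close>.\<close>

definition br :: "int \<Rightarrow> int \<Rightarrow> 'k::comm_ring_1 series" where
  "br i j = (if i < j then monomial [(i, j)] else (\<lambda>u. - monomial [(j, i)] u))"

abbreviation ser_diff :: "'k::comm_ring_1 series \<Rightarrow> 'k series \<Rightarrow> 'k series" where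
  "ser_diff f g \<equiv> (\<lambda>u. f u - g u)"

abbreviation ser_add :: "'k::comm_ring_1 series \<Rightarrow> 'k series \<Rightarrow> 'k series" where
  "ser_add f g \<equiv> (\<lambda>u. f u + g u)"

text \<open>Infinite sum of series, for families in which each word occurs finitely often.\<close>

definition ser_sum :: "'b set \<Rightarrow> ('b \<Rightarrow> 'k::comm_ring_1 series) \<Rightarrow> 'k series" where
  "ser_sum I F = (\<lambda>u. Sum_any (\<lambda>a. if a \<in> I then F a u else 0))"

text \<open>The second three-term relation is found in two forms. \<open>Printed\<close> is
  \<open>[jk][ij] = [ik][jk] + [ik][ij]\<close>. \<open>Mirrored\<close> is \<open>[jk][ij] = [ik][jk] + [ij][ik]\<close>, which is the
  Fomin--Kirillov relation, holds for the action on the nilCoxeter algebra, and already follows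
  from the first relation for the triple \<open>(k, j, i)\<close>. Hence \<open>Mirrored\<close> gives the smaller ideal.\<close>

datatype triangle_form = Printed | Mirrored

inductive_set relators :: "triangle_form \<Rightarrow> nat \<Rightarrow> 'k::comm_ring_1 series set"
  for c :: triangle_form and n :: nat where
  square: "distinct_residues n [i, j] \<Longrightarrow> ser_mult (br i j) (br i j) \<in> relators c n"
| commute: "distinct_residues n [i, j, k, l] \<Longrightarrow>
    ser_diff (ser_mult (br i j) (br k l)) (ser_mult (br k l) (br i j)) \<in> relators c n"
| triangle1: "distinct_residues n [i, j, k] \<Longrightarrow>
    ser_diff (ser_mult (br i j) (br j k))
      (ser_add (ser_mult (br j k) (br i k)) (ser_mult (br i k) (br i j))) \<in> relators c n"
| triangle2: "distinct_residues n [i, j, k] \<Longrightarrow>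
    ser_diff (ser_mult (br j k) (br i j))
      (ser_add (ser_mult (br i k) (br j k))
        (case c of Printed \<Rightarrow> ser_mult (br i k) (br i j)
                 | Mirrored \<Rightarrow> ser_mult (br i j) (br i k))) \<in> relators c n"
| residue_sum: "distinct_residues n [i, j] \<Longrightarrow>
    ser_sum {(i', j'). i' mod int n = i mod int n \<and> j' mod int n = j mod int n}
      (\<lambda>(i', j'). ser_mult (br i j') (br j i')) \<in> relators c n"
| shift: "distinct_residues n [i, j] \<Longrightarrow>
    ser_diff (br i j) (br (i + int n) (j + int n)) \<in> relators c n"

text \<open>All words of the series contain a letter \<open>[ij]\<close> with \<open>\<bar>i - j\<bar> \<ge> N\<close>.\<close>

definition width_filt :: "nat \<Rightarrow> 'k::comm_ring_1 series set" where
  "width_filt N = {f. \<forall>u. f u \<noteq> 0 \<longrightarrow> (\<exists>(i, j) \<in> set u. int N \<le> \<bar>i - j\<bar>)}"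

text \<open>As usual for presentations of topological algebras, the relations generate a closed
  two-sided ideal. (The abstract ideal is too small to express identities between infinite sums:
  its part of degree one consists of finite combinations of the relators \<open>shift\<close>, so it does not
  contain \<open>\<Sum>\<^sub>i \<Sum>\<^sub>j [ij]\<close>, \<open>1 \<le> i \<le> n\<close>.) The closure is taken with respect to the
  shift-invariant filtration by \<open>\<bar>i - j\<bar>\<close>. Since \<open>A\<^sub>w\<close> has only finitely many images under words,
  \<open>A\<^sub>w\<close> is annihilated by \<open>width_filt N\<close> for large \<open>N\<close>, so that the closed ideal has the same
  action as the abstract one. The closure with respect to \<open>index_filt\<close> would not do: by \<open>shift\<close>,
  \<open>[ij]\<close> is congruent to \<open>[i + r n, j + r n]\<close>, which tends to \<open>0\<close> there.\<close>

definition relation_ideal :: "triangle_form \<Rightarrow> nat \<Rightarrow> 'k::comm_ring_1 series set" where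
  "relation_ideal c n = {f \<in> finite_action n.
     \<forall>N. \<exists>g \<in> Idl\<^bsub>E_alg n\<^esub> (relators c n). ser_diff f g \<in> width_filt N}"

definition affine_FK :: "triangle_form \<Rightarrow> nat \<Rightarrow> 'k::comm_ring_1 series set ring" where
  "affine_FK c n = E_alg n Quot relation_ideal c n"

definition dunkl :: "nat \<Rightarrow> int \<Rightarrow> 'k::comm_ring_1 series" where
  "dunkl n i = ser_sum {j. distinct_residues n [i, j]} (\<lambda>j. br i j)"

definition FK_dunkl :: "triangle_form \<Rightarrow> nat \<Rightarrow> int \<Rightarrow> 'k::comm_ring_1 series set" where
  "FK_dunkl c n i = relation_ideal c n +>\<^bsub>E_alg n\<^esub> dunkl n i"

end

theory Submission
  imports Defs "HOL-Algebra.UnivPoly" "HOL-Combinatorics.Orbits"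
begin

text \<open>Modulo series all of whose words contain a letter of width at least \<open>N\<close>, the sums
  \<open>X\<^sub>i\<^sub>j = \<Sum>\<^sub>j\<^sub>' [ij']\<close> over \<open>j' \<equiv> j\<close> are finite. They depend only on the residues of \<open>i\<close> and
  \<open>j\<close>, and they satisfy the relations of the finite Fomin--Kirillov algebra: the relation (d) says
  precisely that \<open>X\<^sub>i\<^sub>j\<^sup>2 = 0\<close>. As \<open>\<theta>\<^sub>i = \<Sum>\<^sub>j X\<^sub>i\<^sub>j\<close>, this reduces the theorem to the finite case.

  There, \<open>x\<^sub>i\<^sub>p x\<^sub>i\<^sub>q = x\<^sub>p\<^sub>q x\<^sub>i\<^sub>p - x\<^sub>i\<^sub>q x\<^sub>p\<^sub>q\<close>. For a cyclic sequence starting with \<open>p, q\<close>,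
  the sums over all rotations \<open>(a\<^sub>1, \<dots>, a\<^sub>k)\<close> of \<open>x\<^sub>i\<^sub>a\<^sub>1 \<cdots> x\<^sub>i\<^sub>a\<^sub>k x\<^sub>i\<^sub>a\<^sub>1\<close> and of \<open>x\<^sub>a\<^sub>1\<^sub>a\<^sub>2 \<cdots> x\<^sub>a\<^sub>1\<^sub>a\<^sub>k\<close>
  are therefore both of the form \<open>x\<^sub>p\<^sub>q S' - S'' x\<^sub>p\<^sub>q\<close>, where \<open>S'\<close> and \<open>S''\<close> are the sums for the
  sequences without \<open>q\<close> and without \<open>p\<close>; by induction they vanish. The first family shows that
  \<open>\<theta>\<^sub>i\<^sup>m\<close> is the sum of \<open>x\<^sub>i\<^sub>a\<^sub>1 \<cdots> x\<^sub>i\<^sub>a\<^sub>m\<close> over distinct \<open>a\<^sub>1, \<dots>, a\<^sub>m\<close>, the second one that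
  these terms cancel when summed over \<open>i\<close>.\<close>

section \<open>Finite sums in rings\<close>

context abelian_monoid
begin

lemma finsum_swap:
  assumes "finite A" "finite B" "\<And>a b. a \<in> A \<Longrightarrow> b \<in> B \<Longrightarrow> f a b \<in> carrier G"
  shows "(\<Oplus>a\<in>A. \<Oplus>b\<in>B. f a b) = (\<Oplus>b\<in>B. \<Oplus>a\<in>A. f a b)"
  using assms(1,3)
proof (induction A rule: finite_induct)
  case (insert a A)
  then have "(\<Oplus>b\<in>B. \<Oplus>a'\<in>insert a A. f a' b) = (\<Oplus>b\<in>B. f a b \<oplus> (\<Oplus>a'\<in>A. f a' b))"
    by (intro finsum_cong') (auto simp: Pi_def)
  also have "\<dots> = (\<Oplus>b\<in>B. f a b) \<oplus> (\<Oplus>b\<in>B. \<Oplus>a'\<in>A. f a' b)"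
    using insert by (intro finsum_addf) (auto simp: Pi_def)
  finally show ?case
    using insert by (simp add: Pi_def)
qed simp

lemma finsum_Sigma:
  assumes "finite A" "\<And>a. a \<in> A \<Longrightarrow> finite (B a)"
    and "\<And>a b. a \<in> A \<Longrightarrow> b \<in> B a \<Longrightarrow> f a b \<in> carrier G"
  shows "(\<Oplus>a\<in>A. \<Oplus>b\<in>B a. f a b) = finsum G (\<lambda>(a, b). f a b) (Sigma A B)"
proof -
  have "Sigma A B = (\<Union>a\<in>A. Pair a ` B a)"
    by auto
  also have "finsum G (\<lambda>(a, b). f a b) \<dots> = (\<Oplus>a\<in>A. finsum G (\<lambda>(a, b). f a b) (Pair a ` B a))"
    using assms by (intro add.finprod_UN_disjoint) (auto simp: pairwise_def disjnt_def)
  also have "\<dots> = (\<Oplus>a\<in>A. \<Oplus>b\<in>B a. f a b)"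
  proof (rule finsum_cong')
    fix a assume "a \<in> A"
    then show "finsum G (\<lambda>(a, b). f a b) (Pair a ` B a) = finsum G (f a) (B a)"
      using assms(3) by (subst finsum_reindex) (auto simp: inj_on_def)
  qed (use assms in auto)
  finally show ?thesis ..
qed

lemma finsum_image_Sigma:
  assumes "finite A" "\<And>a. a \<in> A \<Longrightarrow> finite (B a)" "inj_on (\<lambda>(a, b). h a b) (Sigma A B)"
    and "f \<in> (\<lambda>(a, b). h a b) ` Sigma A B \<rightarrow> carrier G"
  shows "finsum G f ((\<lambda>(a, b). h a b) ` Sigma A B) = (\<Oplus>a\<in>A. \<Oplus>b\<in>B a. f (h a b))"
proof -
  have "finsum G f ((\<lambda>(a, b). h a b) ` Sigma A B) = finsum G (\<lambda>(a, b). f (h a b)) (Sigma A B)"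
    using assms(3,4) by (subst finsum_reindex) (auto intro!: finsum_cong')
  also have "\<dots> = (\<Oplus>a\<in>A. \<Oplus>b\<in>B a. f (h a b))"
    using assms by (intro finsum_Sigma[symmetric]) auto
  finally show ?thesis .
qed

lemma finsum_lessThan_Suc_shift:
  fixes f :: "nat \<Rightarrow> 'a"
  assumes "\<And>r. f r \<in> carrier G"
  shows "finsum G f {..<Suc k} = f 0 \<oplus> (\<Oplus>r\<in>{..<k}. f (Suc r))"
  using assms by (simp add: lessThan_Suc_eq_insert_0 finsum_reindex Pi_def)

lemma finsum_eq_zero_by_orbits:
  assumes "finite D" and f: "f \<in> D \<rightarrow> carrier G"
    and closed: "\<And>S. S \<in> D \<Longrightarrow> \<rho> S \<in> D"
    and period: "k > 0" "\<And>S. S \<in> D \<Longrightarrow> (\<rho> ^^ k) S = S"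
    and free: "\<And>S. S \<in> D \<Longrightarrow> inj_on (\<lambda>r. (\<rho> ^^ r) S) {..<k}"
    and orbit_sum: "\<And>S. S \<in> D \<Longrightarrow> (\<Oplus>r\<in>{..<k}. f ((\<rho> ^^ r) S)) = \<zero>"
  shows "finsum G f D = \<zero>"
proof -
  have orbit_image: "orbit \<rho> S = (\<lambda>r. (\<rho> ^^ r) S) ` {..<k}" if "S \<in> D" for S
    using orbit_altdef_bounded[OF period(2)[OF that] period(1)] by auto
  have orbit_self: "S \<in> orbit \<rho> S" if "S \<in> D" for S
    using period that by (auto simp: orbit_image intro!: image_eqI[of _ _ 0])
  have orbit_subset: "orbit \<rho> S \<subseteq> D" if "S \<in> D" for S
  proof
    fix T assume "T \<in> orbit \<rho> S"
    then show "T \<in> D" by induction (use that closed in auto)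
  qed
  have orbit_eq: "orbit \<rho> T = orbit \<rho> S" if "S \<in> D" "T \<in> orbit \<rho> S" for S T
    using that orbit_trans[of _ \<rho>] orbit_swap[OF orbit_self] by blast
  have "D = \<Union>(orbit \<rho> ` D)"
    using orbit_self orbit_subset by blast
  also have "finsum G f \<dots> = (\<Oplus>C\<in>orbit \<rho> ` D. finsum G f C)"
  proof (rule add.finprod_Union_disjoint)
    show "pairwise disjnt (orbit \<rho> ` D)"
      using orbit_eq unfolding pairwise_def disjnt_iff by (metis imageE)
    show "finite C \<and> (\<forall>S\<in>C. f S \<in> carrier G)" if "C \<in> orbit \<rho> ` D" for C
      using that f orbit_subset by (auto simp: orbit_image)
  qed (use \<open>finite D\<close> in simp)
  also have "finsum G f (orbit \<rho> S) = \<zero>" if "S \<in> D" for S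
    using that free orbit_sum f orbit_subset[OF that] unfolding orbit_image[OF that]
    by (subst finsum_reindex) (auto simp: Pi_iff)
  then have "(\<Oplus>C\<in>orbit \<rho> ` D. finsum G f C) = \<zero>"
    using add.finprod_one_eqI[of "orbit \<rho> ` D" "finsum G f"] by blast
  finally show ?thesis .
qed

end

context ring
begin

lemma finsum_a_inv:
  "f \<in> A \<rightarrow> carrier R \<Longrightarrow> (\<Oplus>a\<in>A. \<ominus> f a) = \<ominus> finsum R f A"
  by (induction A rule: infinite_finite_induct) (auto simp: Pi_def minus_add)

lemma finsum_minus:
  assumes "f \<in> A \<rightarrow> carrier R" "g \<in> A \<rightarrow> carrier R"
  shows "(\<Oplus>a\<in>A. f a \<ominus> g a) = finsum R f A \<ominus> finsum R g A"
  unfolding a_minus_def finsum_a_inv[OF assms(2), symmetric]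
  using assms by (intro finsum_addf) auto

lemma finsum_commute:
  assumes "finite A" "z \<in> carrier R" "f \<in> A \<rightarrow> carrier R" "\<And>a. a \<in> A \<Longrightarrow> f a \<otimes> z = z \<otimes> f a"
  shows "finsum R f A \<otimes> z = z \<otimes> finsum R f A"
  using assms by (auto simp: finsum_ldistr finsum_rdistr intro!: finsum_cong')

lemma finsum_product:
  assumes "finite A" "finite B" "f \<in> A \<rightarrow> carrier R" "g \<in> B \<rightarrow> carrier R"
  shows "finsum R f A \<otimes> finsum R g B = (\<Oplus>a\<in>A. \<Oplus>b\<in>B. f a \<otimes> g b)"
  using assms by (subst finsum_ldistr) (auto simp: finsum_rdistr Pi_iff intro!: finsum_cong')

end

section \<open>Sums over lists of distinct elements\<close>

definition rotation_sum :: "('a, 'b) ring_scheme \<Rightarrow> ('v list \<Rightarrow> 'a) \<Rightarrow> 'v list \<Rightarrow> 'a" where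
  "rotation_sum R f T = (\<Oplus>\<^bsub>R\<^esub>r\<in>{..<length T}. f (rotate r T))"

definition distinct_lists :: "nat \<Rightarrow> 'v set \<Rightarrow> 'v list set" where
  "distinct_lists k A = {S. length S = k \<and> distinct S \<and> set S \<subseteq> A}"

lemma finite_distinct_lists: "finite A \<Longrightarrow> finite (distinct_lists k A)"
  by (rule finite_subset[OF _ finite_lists_length_eq[of A k]]) (auto simp: distinct_lists_def)

lemma distinct_lists_0: "distinct_lists 0 A = {[]}"
  by (auto simp: distinct_lists_def)

lemma distinct_lists_Suc:
  "distinct_lists (Suc k) A = (\<lambda>(a, S). a # S) ` (SIGMA a:A. distinct_lists k (A - {a}))"
  by (fastforce simp: distinct_lists_def length_Suc_conv image_iff)

lemma distinct_lists_Suc_snoc: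
  "distinct_lists (Suc k) A = (\<lambda>(S, a). S @ [a]) ` (SIGMA S:distinct_lists k A. A - set S)"
  by (fastforce simp: distinct_lists_def length_Suc_conv_rev image_iff)

lemma list_insert2_induct [case_names Nil singleton insert2]:
  assumes "P []" "\<And>p. P [p]" "\<And>p q T. P (p # T) \<Longrightarrow> P (q # T) \<Longrightarrow> P (p # q # T)"
  shows "P T"
proof (induction "length T" arbitrary: T rule: less_induct)
  case less
  then show ?case
    using assms by (cases T rule: remdups_adj.cases) auto
qed

lemma rotate_append_left: "r \<le> length T \<Longrightarrow> rotate r (T @ U) = drop r T @ U @ take r T"
  by (metis append_assoc append_take_drop_id length_take min.absorb2 rotate_append)

lemma inj_on_rotate:
  assumes "distinct T"
  shows "inj_on (\<lambda>r. rotate r T) {..<length T}"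
proof (rule inj_onI)
  fix r s assume r: "r \<in> {..<length T}" and s: "s \<in> {..<length T}"
  assume "rotate r T = rotate s T"
  then have "hd (rotate r T) = hd (rotate s T)" by simp
  moreover have "T \<noteq> []" using r by auto
  ultimately show "r = s"
    using assms r s by (simp add: hd_rotate_conv_nth nth_eq_iff_index_eq)
qed

context abelian_monoid
begin

lemma rotation_sum_singleton [simp]: "f [p] \<in> carrier G \<Longrightarrow> rotation_sum G f [p] = f [p]"
  by (simp add: rotation_sum_def lessThan_Suc)

lemma finsum_distinct_lists_Cons:
  assumes "finite A" "f \<in> distinct_lists (Suc k) A \<rightarrow> carrier G"
  shows "finsum G f (distinct_lists (Suc k) A) = (\<Oplus>a\<in>A. \<Oplus>S\<in>distinct_lists k (A - {a}). f (a # S))"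
  using assms unfolding distinct_lists_Suc
  by (intro finsum_image_Sigma) (auto simp: finite_distinct_lists inj_on_def)

lemma finsum_distinct_lists_snoc:
  assumes "finite A" "f \<in> distinct_lists (Suc k) A \<rightarrow> carrier G"
  shows "finsum G f (distinct_lists (Suc k) A) =
    (\<Oplus>S\<in>distinct_lists k A. \<Oplus>a\<in>A - set S. f (S @ [a]))"
  using assms unfolding distinct_lists_Suc_snoc
  by (intro finsum_image_Sigma) (auto simp: finite_distinct_lists inj_on_def)

text \<open>Rotation acts freely on lists of distinct elements, so no division by the length is
  needed.\<close>

lemma finsum_distinct_lists_eq_zero_by_rotation:
  assumes "finite A" "j < k" and f: "f \<in> distinct_lists k A \<rightarrow> carrier G"
    and rotations: "\<And>S. S \<in> distinct_lists k A \<Longrightarrow>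
      rotation_sum G (\<lambda>T. f (take j S @ T)) (drop j S) = \<zero>"
  shows "finsum G f (distinct_lists k A) = \<zero>"
proof (rule finsum_eq_zero_by_orbits)
  define \<rho> where "\<rho> S = take j S @ rotate1 (drop j S)" for S :: "'c list"
  have funpow_\<rho>: "(\<rho> ^^ r) S = take j S @ rotate r (drop j S)" if "S \<in> distinct_lists k A" for r S
    using that \<open>j < k\<close> by (induction r) (auto simp: \<rho>_def distinct_lists_def)
  show "finite (distinct_lists k A)"
    using assms(1) by (rule finite_distinct_lists)
  show "0 < k - j"
    using \<open>j < k\<close> by simp
  fix S assume S: "S \<in> distinct_lists k A"
  then have length_S: "length (drop j S) = k - j" and distinct_S: "distinct S"
    by (auto simp: distinct_lists_def)
  have "\<rho> S \<in> distinct_lists k A \<longleftrightarrow> take j S @ drop j S \<in> distinct_lists k A"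
    by (simp add: \<rho>_def distinct_lists_def del: append_take_drop_id)
  then show "\<rho> S \<in> distinct_lists k A"
    using S by simp
  show "(\<rho> ^^ (k - j)) S = S"
    using length_S by (simp add: funpow_\<rho>[OF S])
  show "inj_on (\<lambda>r. (\<rho> ^^ r) S) {..<k - j}"
    using inj_on_rotate[OF distinct_drop[OF distinct_S, of j]] length_S
    by (simp add: funpow_\<rho>[OF S] inj_on_def)
  show "(\<Oplus>r\<in>{..<k - j}. f ((\<rho> ^^ r) S)) = \<zero>"
    using rotations[OF S] length_S by (simp add: rotation_sum_def funpow_\<rho>[OF S])
qed (rule f)

end

context ring
begin

text \<open>\<open>c\<close> is the term by which the words starting with \<open>p\<close> and with \<open>q\<close> fail to follow the
  pattern of the others.\<close>

lemma rotation_sum_insert2: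
  assumes z_closed: "z \<in> carrier R" and c_closed: "c \<in> carrier R" and f: "f \<in> UNIV \<rightarrow> carrier R"
    and first: "f (p # q # T) = z \<otimes> f (p # T) \<ominus> c"
    and second: "f (q # T @ [p]) = c \<ominus> f (q # T) \<otimes> z"
    and inner: "\<And>A B. A \<noteq> [] \<Longrightarrow> T = B @ A \<Longrightarrow>
      f (A @ p # q # B) = z \<otimes> f (A @ p # B) \<ominus> f (A @ q # B) \<otimes> z"
  shows "rotation_sum R f (p # q # T) =
    z \<otimes> rotation_sum R f (p # T) \<ominus> rotation_sum R f (q # T) \<otimes> z"
proof -
  define inner_sum where "inner_sum U = (\<Oplus>r\<in>{..<length T}. f (drop r T @ U @ take r T))" for U
  have f_closed [simp]: "f S \<in> carrier R" for S
    using f by blast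
  have inner_closed [simp]: "inner_sum U \<in> carrier R" for U
    by (simp add: inner_sum_def Pi_def)
  have inner_sum_eq: "(\<Oplus>r\<in>{..<length T}. f (rotate r (T @ U))) = inner_sum U" for U
    unfolding inner_sum_def by (intro finsum_cong') (simp_all add: rotate_append_left)
  have rotation_sum_Cons: "rotation_sum R f (a # T) = f (a # T) \<oplus> inner_sum [a]" for a
    by (simp add: rotation_sum_def finsum_lessThan_Suc_shift rotate1_rotate_swap inner_sum_eq)
  have "inner_sum [p, q] = (\<Oplus>r\<in>{..<length T}.
      z \<otimes> f (drop r T @ [p] @ take r T) \<ominus> f (drop r T @ [q] @ take r T) \<otimes> z)"
    unfolding inner_sum_def using z_closed by (intro finsum_cong') (auto intro!: inner)
  also have "\<dots> = z \<otimes> inner_sum [p] \<ominus> inner_sum [q] \<otimes> z"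
    unfolding inner_sum_def using z_closed
    by (subst finsum_minus) (auto simp: finsum_ldistr finsum_rdistr Pi_def)
  finally have inner_sum_insert2: "inner_sum [p, q] = z \<otimes> inner_sum [p] \<ominus> inner_sum [q] \<otimes> z" .
  have "rotation_sum R f (p # q # T) = f (p # q # T) \<oplus> (f (q # T @ [p]) \<oplus> inner_sum [p, q])"
    by (simp add: rotation_sum_def finsum_lessThan_Suc_shift rotate1_rotate_swap inner_sum_eq)
  then show ?thesis
    using z_closed c_closed unfolding inner_sum_insert2 rotation_sum_Cons first second
    by (simp add: a_minus_def minus_add l_distr r_distr a_ac r_neg1 r_neg2)
qed

end

section \<open>Dunkl elements in rings with Fomin--Kirillov relations\<close>

locale FK_ring = ring R for R :: "('a, 'b) ring_scheme" (structure) +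
  fixes V :: "'v set" and x :: "'v \<Rightarrow> 'v \<Rightarrow> 'a"
  assumes finite_V: "finite V"
    and x_closed [simp]: "x i j \<in> carrier R"
    and x_anti: "i \<in> V \<Longrightarrow> j \<in> V \<Longrightarrow> i \<noteq> j \<Longrightarrow> x j i = \<ominus> x i j"
    and x_square: "i \<in> V \<Longrightarrow> j \<in> V \<Longrightarrow> i \<noteq> j \<Longrightarrow> x i j \<otimes> x i j = \<zero>"
    and x_commute: "{i, j, k, l} \<subseteq> V \<Longrightarrow> distinct [i, j, k, l] \<Longrightarrow>
      x i j \<otimes> x k l = x k l \<otimes> x i j"
    and x_triangle: "{i, j, k} \<subseteq> V \<Longrightarrow> distinct [i, j, k] \<Longrightarrow>
      x i j \<otimes> x j k = x j k \<otimes> x i k \<oplus> x i k \<otimes> x i j"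
begin

primrec star_word :: "'v \<Rightarrow> 'v list \<Rightarrow> 'a" where
  "star_word i [] = \<one>"
| "star_word i (a # S) = x i a \<otimes> star_word i S"

lemma star_word_closed [simp]: "star_word i S \<in> carrier R"
  by (induction S) simp_all

lemma star_word_append [simp]: "star_word i (S @ T) = star_word i S \<otimes> star_word i T"
  by (induction S) (simp_all add: m_assoc)

lemma star_word_commute:
  assumes "{i, p, q} \<subseteq> V" "distinct [i, p, q]" "set S \<subseteq> V - {i, p, q}"
  shows "star_word i S \<otimes> x p q = x p q \<otimes> star_word i S"
  using assms(3)
proof (induction S)
  case (Cons s S)
  then have "x i s \<otimes> x p q = x p q \<otimes> x i s"
    using assms by (intro x_commute) auto
  then show ?case
    using Cons by (simp add: m_assoc) (simp flip: m_assoc)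
qed simp

lemma star_relation:
  assumes "{i, p, q} \<subseteq> V" "distinct [i, p, q]"
  shows "x i p \<otimes> x i q = x p q \<otimes> x i p \<ominus> x i q \<otimes> x p q"
proof -
  have anti: "x i p = \<ominus> x p i" "x p i = \<ominus> x i p"
    using assms by (auto intro: x_anti)
  have "x i p \<otimes> x i q = \<ominus> (x p i \<otimes> x i q)"
    unfolding anti(1) by (simp add: l_minus)
  also have "x p i \<otimes> x i q = x i q \<otimes> x p q \<oplus> x p q \<otimes> x p i"
    using assms by (intro x_triangle) auto
  also have "\<ominus> \<dots> = x p q \<otimes> x i p \<ominus> x i q \<otimes> x p q"
    unfolding anti(2) by (simp add: minus_add r_minus a_minus_def a_comm)
  finally show ?thesis .
qed

lemma star_word_insert2:
  assumes "{i, p, q} \<subseteq> V" "distinct [i, p, q]" "set P \<union> set Q \<subseteq> V - {i, p, q}"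
  shows "star_word i (Q @ p # q # P) =
    x p q \<otimes> star_word i (Q @ p # P) \<ominus> star_word i (Q @ q # P) \<otimes> x p q"
proof -
  have "star_word i (Q @ p # q # P) = star_word i Q \<otimes> (x i p \<otimes> x i q) \<otimes> star_word i P"
    by (simp add: m_assoc)
  also have "\<dots> = (star_word i Q \<otimes> x p q) \<otimes> x i p \<otimes> star_word i P
      \<ominus> star_word i Q \<otimes> x i q \<otimes> (x p q \<otimes> star_word i P)"
    unfolding star_relation[OF assms(1,2)]
    by (simp add: a_minus_def l_distr r_distr l_minus r_minus m_assoc)
  also have "\<dots> = (x p q \<otimes> star_word i Q) \<otimes> x i p \<otimes> star_word i P
      \<ominus> star_word i Q \<otimes> x i q \<otimes> (star_word i P \<otimes> x p q)"
    using assms by (simp add: star_word_commute)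
  finally show ?thesis by (simp add: m_assoc)
qed

lemma rotation_sum_closed_star_word_eq_zero:
  assumes "i \<in> V" "T \<noteq> []" "distinct T" "set T \<subseteq> V - {i}"
  shows "rotation_sum R (\<lambda>S. star_word i S \<otimes> x i (hd S)) T = \<zero>"
  using assms(2-)
proof (induction T rule: list_insert2_induct)
  case (singleton p)
  then show ?case
    using assms(1) by (auto intro: x_square)
next
  case (insert2 p q T)
  let ?f = "\<lambda>S. star_word i S \<otimes> x i (hd S)"
  have distinct_ipq: "{i, p, q} \<subseteq> V" "distinct [i, p, q]" and T: "set T \<subseteq> V - {i, p, q}"
    using insert2.prems assms(1) by auto
  have "rotation_sum R ?f (p # q # T) =
      x p q \<otimes> rotation_sum R ?f (p # T) \<ominus> rotation_sum R ?f (q # T) \<otimes> x p q"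
  proof (rule rotation_sum_insert2)
    show "?f (p # q # T) =
        x p q \<otimes> ?f (p # T) \<ominus> x i q \<otimes> star_word i T \<otimes> x p q \<otimes> x i p"
      using star_word_insert2[OF distinct_ipq, of T "[]"] T
      by (simp add: a_minus_def l_distr l_minus m_assoc)
    show "?f (q # T @ [p]) =
        x i q \<otimes> star_word i T \<otimes> x p q \<otimes> x i p \<ominus> ?f (q # T) \<otimes> x p q"
      by (simp add: m_assoc star_relation[OF distinct_ipq] a_minus_def r_distr r_minus)
    fix A B assume "A \<noteq> []" and "T = B @ A"
    then have hd_A: "hd (A @ S) = hd A" "hd A \<in> V - {i, p, q}" for S
      using T by (auto simp: subset_iff)
    then have "x i (hd A) \<otimes> x p q = x p q \<otimes> x i (hd A)"
      using distinct_ipq by (intro x_commute) auto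
    then show "?f (A @ p # q # B) = x p q \<otimes> ?f (A @ p # B) \<ominus> ?f (A @ q # B) \<otimes> x p q"
      using star_word_insert2[OF distinct_ipq, of B A] T \<open>T = B @ A\<close>
      by (simp add: hd_A(1) a_minus_def l_distr l_minus m_assoc del: star_word_append star_word.simps)
  qed simp_all
  then show ?case
    using insert2 by (simp add: a_minus_def)
qed simp

lemma rotation_sum_star_word_eq_zero:
  assumes "length T \<ge> 2" "distinct T" "set T \<subseteq> V"
  shows "rotation_sum R (\<lambda>S. star_word (hd S) (tl S)) T = \<zero>"
  using assms
proof (induction T rule: list_insert2_induct)
  case (insert2 p q T)
  let ?f = "\<lambda>S. star_word (hd S) (tl S)"
  have distinct_pq: "p \<in> V" "q \<in> V" "p \<noteq> q" and T: "set T \<subseteq> V - {p, q}" "distinct T"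
    using insert2.prems by auto
  have "rotation_sum R ?f (p # q # T) =
      x p q \<otimes> rotation_sum R ?f (p # T) \<ominus> rotation_sum R ?f (q # T) \<otimes> x p q"
  proof (rule rotation_sum_insert2)
    show "?f (p # q # T) = x p q \<otimes> ?f (p # T) \<ominus> \<zero>"
      by (simp add: a_minus_def)
    show "?f (q # T @ [p]) = \<zero> \<ominus> ?f (q # T) \<otimes> x p q"
      using distinct_pq x_anti[of p q] by (simp add: a_minus_def r_minus)
    fix A B assume "A \<noteq> []" and T_eq: "T = B @ A"
    then obtain h A' where "A = h # A'" by (cases A) auto
    then show "?f (A @ p # q # B) = x p q \<otimes> ?f (A @ p # B) \<ominus> ?f (A @ q # B) \<otimes> x p q"
      using star_word_insert2[of h p q B A'] distinct_pq T T_eq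
      by (auto simp del: star_word_append star_word.simps)
  qed simp_all
  also have "\<dots> = \<zero>"
    using insert2.IH insert2.prems by (cases T) (simp_all add: a_minus_def r_neg)
  finally show ?case .
qed simp_all

lemma finsum_repeated_letter_at_eq_zero:
  assumes "i \<in> V" "r < k"
  shows "(\<Oplus>S\<in>distinct_lists k (V - {i}). star_word i S \<otimes> x i (S ! r)) = \<zero>"
proof (rule finsum_distinct_lists_eq_zero_by_rotation)
  let ?closed = "\<lambda>T. star_word i T \<otimes> x i (hd T)"
  fix S assume S: "S \<in> distinct_lists k (V - {i})"
  then have length_S: "r \<le> length S" "drop r S \<noteq> []" and set_drop: "set (drop r S) \<subseteq> V - {i}"
    using assms(2) set_drop_subset[of r S] by (auto simp: distinct_lists_def)
  have "rotation_sum R (\<lambda>T. star_word i (take r S @ T) \<otimes> x i ((take r S @ T) ! r)) (drop r S) =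
      (\<Oplus>q\<in>{..<length (drop r S)}. star_word i (take r S) \<otimes> ?closed (rotate q (drop r S)))"
    unfolding rotation_sum_def using length_S
    by (intro finsum_cong') (simp_all add: nth_append hd_conv_nth m_assoc min_def)
  also have "\<dots> = star_word i (take r S) \<otimes> rotation_sum R ?closed (drop r S)"
    by (simp add: rotation_sum_def finsum_rdistr)
  also have "\<dots> = \<zero>"
    using S length_S(2) set_drop assms(1)
    by (simp add: rotation_sum_closed_star_word_eq_zero distinct_lists_def)
  finally show "rotation_sum R (\<lambda>T. star_word i (take r S @ T) \<otimes> x i ((take r S @ T) ! r))
      (drop r S) = \<zero>" .
qed (use assms(2) finite_V in simp_all)

lemma finsum_repeated_letter_eq_zero:
  assumes "i \<in> V"
  shows "(\<Oplus>S\<in>distinct_lists k (V - {i}). \<Oplus>a\<in>set S. star_word i S \<otimes> x i a) = \<zero>"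
proof -
  let ?D = "distinct_lists k (V - {i})"
  have "(\<Oplus>S\<in>?D. \<Oplus>a\<in>set S. star_word i S \<otimes> x i a) =
      (\<Oplus>S\<in>?D. \<Oplus>r\<in>{..<k}. star_word i S \<otimes> x i (S ! r))"
  proof (rule finsum_cong')
    fix S assume "S \<in> ?D"
    then have "inj_on ((!) S) {..<k}" "set S = (!) S ` {..<k}"
      using bij_betw_nth[of S] by (auto simp: distinct_lists_def bij_betw_def)
    then show "(\<Oplus>a\<in>set S. star_word i S \<otimes> x i a) = (\<Oplus>r\<in>{..<k}. star_word i S \<otimes> x i (S ! r))"
      by (simp add: finsum_reindex)
  qed simp_all
  also have "\<dots> = (\<Oplus>r\<in>{..<k}. \<Oplus>S\<in>?D. star_word i S \<otimes> x i (S ! r))"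
    using finite_V by (intro finsum_swap) (auto intro: finite_distinct_lists)
  also have "\<dots> = \<zero>"
    using assms by (intro add.finprod_one_eqI finsum_repeated_letter_at_eq_zero) simp_all
  finally show ?thesis .
qed

lemma dunkl_power:
  assumes "i \<in> V"
  shows "(\<Oplus>j\<in>V - {i}. x i j) [^] (k :: nat) = (\<Oplus>S\<in>distinct_lists k (V - {i}). star_word i S)"
proof (induction k)
  case 0
  then show ?case by (simp add: distinct_lists_0)
next
  case (Suc k)
  let ?A = "V - {i}" and ?term = "\<lambda>S a. star_word i S \<otimes> x i a"
  let ?D = "distinct_lists k ?A"
  have finite_A_D: "finite ?A" "finite ?D"
    using finite_V by (auto intro: finite_distinct_lists)
  have "(\<Oplus>j\<in>?A. x i j) [^] Suc k = (\<Oplus>S\<in>?D. star_word i S) \<otimes> (\<Oplus>a\<in>?A. x i a)"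
    by (simp add: Suc)
  also have "\<dots> = (\<Oplus>S\<in>?D. \<Oplus>a\<in>?A. ?term S a)"
    using finite_A_D by (simp add: finsum_product)
  also have "\<dots> = (\<Oplus>S\<in>?D. (\<Oplus>a\<in>?A - set S. ?term S a) \<oplus> (\<Oplus>a\<in>set S. ?term S a))"
  proof (intro finsum_cong' refl)
    fix S assume "S \<in> ?D"
    then have "?A = (?A - set S) \<union> set S" by (auto simp: distinct_lists_def)
    then show "(\<Oplus>a\<in>?A. ?term S a) = (\<Oplus>a\<in>?A - set S. ?term S a) \<oplus> (\<Oplus>a\<in>set S. ?term S a)"
      using finsum_Un_disjoint[of "?A - set S" "set S" "?term S"] finite_A_D(1) by auto
  qed simp_all
  also have "\<dots> = (\<Oplus>S\<in>?D. \<Oplus>a\<in>?A - set S. star_word i (S @ [a]))"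
    using finsum_repeated_letter_eq_zero[OF assms] by (simp add: finsum_addf)
  also have "\<dots> = (\<Oplus>S\<in>distinct_lists (Suc k) ?A. star_word i S)"
    using finite_A_D(1) by (simp add: finsum_distinct_lists_snoc)
  finally show ?case .
qed

theorem dunkl_power_sum:
  fixes m :: nat
  assumes "m \<ge> 1"
  shows "(\<Oplus>i\<in>V. (\<Oplus>j\<in>V - {i}. x i j) [^] m) = \<zero>"
proof -
  have "(\<Oplus>i\<in>V. (\<Oplus>j\<in>V - {i}. x i j) [^] m) =
      (\<Oplus>i\<in>V. \<Oplus>S\<in>distinct_lists m (V - {i}). star_word i S)"
    by (intro finsum_cong') (simp_all add: dunkl_power)
  also have "\<dots> = (\<Oplus>T\<in>distinct_lists (Suc m) V. star_word (hd T) (tl T))"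
    using finite_V by (simp add: finsum_distinct_lists_Cons)
  also have "\<dots> = \<zero>"
  proof (rule finsum_distinct_lists_eq_zero_by_rotation)
    fix S assume "S \<in> distinct_lists (Suc m) V"
    then show "rotation_sum R (\<lambda>T. star_word (hd (take 0 S @ T)) (tl (take 0 S @ T)))
        (drop 0 S) = \<zero>"
      using rotation_sum_star_word_eq_zero[of S] assms by (simp add: distinct_lists_def)
  qed (use finite_V in simp_all)
  finally show ?thesis .
qed

end

section \<open>From affine to finite relations\<close>

lemma distinct_residues_iff_distinct:
  assumes "set xs \<subseteq> {1..int n}"
  shows "distinct_residues n xs \<longleftrightarrow> distinct xs"
proof -
  have "inj_on (\<lambda>x. x mod int n) {1..int n}"
  proof (rule inj_onI)
    fix x y assume xy: "x \<in> {1..int n}" "y \<in> {1..int n}" "x mod int n = y mod int n"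
    then have "int n dvd x - y" by (simp add: mod_eq_dvd_iff)
    moreover have "\<bar>x - y\<bar> < int n" using xy by auto
    ultimately show "x = y"
      using dvd_imp_le_int[of "x - y" "int n"] by fastforce
  qed
  then show ?thesis
    using assms by (auto simp: distinct_residues_def distinct_map intro: inj_on_subset)
qed

lemma residue_representative:
  assumes "n > 0"
  obtains j0 where "j0 \<in> {1..int n}" "j0 mod int n = j mod int n"
proof
  show "(j - 1) mod int n + 1 \<in> {1..int n}"
    using assms by (simp add: add1_zle_eq)
  show "((j - 1) mod int n + 1) mod int n = j mod int n"
    by (simp add: mod_simps)
qed

definition residue_window :: "nat \<Rightarrow> nat \<Rightarrow> int \<Rightarrow> int \<Rightarrow> int set" where
  "residue_window n M c j = {j'. j' mod int n = j mod int n \<and> \<bar>j' - c\<bar> < int M}"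

lemma finite_residue_window [simp]: "finite (residue_window n M c j)"
  by (rule finite_subset[of _ "{c - int M..c + int M}"]) (auto simp: residue_window_def)

locale affine_FK_ring = ring R for R :: "('a, 'b) ring_scheme" (structure) +
  fixes n N :: nat and b :: "int \<Rightarrow> int \<Rightarrow> 'a"
  assumes n_pos: "n > 0"
    and b_closed [simp]: "b i j \<in> carrier R"
    and b_anti: "b j i = \<ominus> b i j"
    and b_shift: "b (i + int n) (j + int n) = b i j"
    and b_wide: "int N \<le> \<bar>i - j\<bar> \<Longrightarrow> b i j = \<zero>"
    and b_commute: "distinct_residues n [i, j, k, l] \<Longrightarrow> b i j \<otimes> b k l = b k l \<otimes> b i j"
    and b_triangle: "distinct_residues n [i, j, k] \<Longrightarrow>
      b i j \<otimes> b j k = b j k \<otimes> b i k \<oplus> b i k \<otimes> b i j"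
    and b_residue: "distinct_residues n [i, j] \<Longrightarrow>
      (\<Oplus>j'\<in>residue_window n N i j. b i j') \<otimes> (\<Oplus>i'\<in>residue_window n N j i. b j i') = \<zero>"
begin

definition residue_bracket :: "int \<Rightarrow> int \<Rightarrow> 'a" where
  "residue_bracket i j = (\<Oplus>j'\<in>residue_window n N i j. b i j')"

lemma residue_bracket_closed [simp]: "residue_bracket i j \<in> carrier R"
  by (simp add: residue_bracket_def Pi_def)

lemma b_shift_cong:
  assumes "i mod int n = i' mod int n" "j - i = j' - i'"
  shows "b i j = b i' j'"
proof -
  obtain q where "i - i' = int n * q"
    using assms(1) by (metis mod_eq_dvd_iff dvdE)
  then have i: "i = i' + q * int n" and j: "j = j' + q * int n"
    using assms(2) by (simp_all add: algebra_simps)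
  have "b (i' + q * int n) (j' + q * int n) = b i' j'" for q
  proof (induction q rule: int_induct[of _ 0])
    case (step1 q)
    then show ?case
      using b_shift[of "i' + q * int n" "j' + q * int n"] by (simp add: algebra_simps)
  next
    case (step2 q)
    then show ?case
      using b_shift[of "i' + (q - 1) * int n" "j' + (q - 1) * int n"] by (simp add: algebra_simps)
  qed simp
  then show ?thesis
    unfolding i j by simp
qed

lemma residue_bracket_anti: "residue_bracket j i = \<ominus> residue_bracket i j"
proof -
  have "residue_window n N i j = (\<lambda>i'. i + j - i') ` residue_window n N j i"
    by (intro equalityI subsetI image_eqI[of _ _ "i + j - _"])
      (auto simp: residue_window_def mod_eq_dvd_iff dvd_diff_commute)
  then have "residue_bracket i j = (\<Oplus>i'\<in>residue_window n N j i. b i (i + j - i'))"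
    by (simp add: residue_bracket_def finsum_reindex inj_on_def)
  also have "\<dots> = (\<Oplus>i'\<in>residue_window n N j i. \<ominus> b j i')"
  proof (rule finsum_cong')
    fix i' assume "i' \<in> residue_window n N j i"
    then have "b i (i + j - i') = b i' j"
      by (intro b_shift_cong) (auto simp: residue_window_def)
    then show "b i (i + j - i') = \<ominus> b j i'"
      by (simp add: b_anti[of i' j])
  qed simp_all
  finally show ?thesis
    by (simp add: finsum_a_inv residue_bracket_def)
qed

lemma residue_bracket_row:
  assumes "int N + \<bar>i - c\<bar> \<le> int M"
  shows "residue_bracket i j = (\<Oplus>j'\<in>residue_window n M c j. b i j')"
  unfolding residue_bracket_def
proof (rule add.finprod_mono_neutral_cong_left)
  fix j' assume "j' \<in> residue_window n M c j - residue_window n N i j"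
  then show "b i j' = \<zero>"
    by (intro b_wide) (auto simp: residue_window_def)
next
  show "residue_window n N i j \<subseteq> residue_window n M c j"
    using assms by (auto simp: residue_window_def)
qed simp_all

lemma residue_bracket_column:
  assumes "int N + \<bar>j - c\<bar> \<le> int M"
  shows "residue_bracket i j = (\<Oplus>i'\<in>residue_window n M c i. b i' j)"
  using residue_bracket_row[OF assms, of i]
  by (simp add: residue_bracket_anti[of i j] b_anti[of _ j] finsum_a_inv)

lemma residue_bracket_cong:
  assumes "i mod int n = i' mod int n" "j mod int n = j' mod int n"
  shows "residue_bracket i j = residue_bracket i' j'"
proof -
  have "residue_bracket i j = residue_bracket i' j"
    using assms(1) by (simp add: residue_bracket_column[of j j N] residue_window_def)
  also have "\<dots> = residue_bracket i' j'"
    using assms(2) by (simp add: residue_bracket_def residue_window_def)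
  finally show ?thesis .
qed

lemma residue_bracket_square:
  assumes "distinct_residues n [i, j]"
  shows "residue_bracket i j \<otimes> residue_bracket i j = \<zero>"
proof -
  have "residue_bracket i j \<otimes> residue_bracket i j = \<ominus> (residue_bracket i j \<otimes> residue_bracket j i)"
    by (simp add: residue_bracket_anti[of j i] r_minus)
  then show ?thesis
    using b_residue[OF assms] by (simp add: residue_bracket_def)
qed

lemma residue_bracket_commute:
  assumes "distinct_residues n [i, j, k, l]"
  shows "residue_bracket i j \<otimes> residue_bracket k l = residue_bracket k l \<otimes> residue_bracket i j"
proof -
  have "b i j' \<otimes> b k l' = b k l' \<otimes> b i j'"
    if "j' \<in> residue_window n N i j" "l' \<in> residue_window n N k l" for j' l'
    using that assms by (intro b_commute) (auto simp: residue_window_def distinct_residues_def)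
  then have "residue_bracket k l \<otimes> b i j' = b i j' \<otimes> residue_bracket k l"
    if "j' \<in> residue_window n N i j" for j'
    unfolding residue_bracket_def using that by (intro finsum_commute) auto
  then show ?thesis
    unfolding residue_bracket_def[of i j] by (intro finsum_commute) auto
qed

text \<open>Terms with \<open>\<bar>i - j'\<bar> \<ge> N\<close> vanish, and for all others the window of radius \<open>N\<close> around \<open>j'\<close>
  lies in the window of radius \<open>2 N\<close> around \<open>i\<close>. So the three products of the triangle relation can
  be expanded over the same pairs \<open>(j', k')\<close>.\<close>

lemma residue_bracket_product_row:
  "residue_bracket i j \<otimes> residue_bracket j k =
    (\<Oplus>j'\<in>residue_window n (2 * N) i j. \<Oplus>k'\<in>residue_window n (2 * N) i k. b i j' \<otimes> b j' k')"
proof -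
  let ?A = "residue_window n (2 * N) i j" and ?B = "residue_window n (2 * N) i k"
  have "b i j' \<otimes> residue_bracket j k = (\<Oplus>k'\<in>?B. b i j' \<otimes> b j' k')" if "j' \<in> ?A" for j'
  proof (cases "\<bar>i - j'\<bar> < int N")
    case True
    then have "residue_bracket j' k = (\<Oplus>k'\<in>?B. b j' k')"
      by (intro residue_bracket_row) simp
    moreover have "residue_bracket j k = residue_bracket j' k"
      using that by (intro residue_bracket_cong) (simp_all add: residue_window_def)
    ultimately show ?thesis
      by (simp add: finsum_rdistr)
  qed (simp add: b_wide)
  moreover have "residue_bracket i j = (\<Oplus>j'\<in>?A. b i j')"
    by (rule residue_bracket_row) simp
  ultimately show ?thesis
    by (auto simp: finsum_ldistr intro!: finsum_cong')
qed

lemma residue_bracket_product_column: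
  "residue_bracket j k \<otimes> residue_bracket i k =
    (\<Oplus>k'\<in>residue_window n (2 * N) i k. \<Oplus>j'\<in>residue_window n (2 * N) i j. b j' k' \<otimes> b i k')"
proof -
  let ?A = "residue_window n (2 * N) i j" and ?B = "residue_window n (2 * N) i k"
  have "residue_bracket j k \<otimes> b i k' = (\<Oplus>j'\<in>?A. b j' k' \<otimes> b i k')" if "k' \<in> ?B" for k'
  proof (cases "\<bar>i - k'\<bar> < int N")
    case True
    then have "residue_bracket j k' = (\<Oplus>j'\<in>?A. b j' k')"
      by (intro residue_bracket_column) simp
    moreover have "residue_bracket j k = residue_bracket j k'"
      using that by (intro residue_bracket_cong) (simp_all add: residue_window_def)
    ultimately show ?thesis
      by (simp add: finsum_ldistr)
  qed (simp add: b_wide)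
  moreover have "residue_bracket i k = (\<Oplus>k'\<in>?B. b i k')"
    by (rule residue_bracket_row) simp
  ultimately show ?thesis
    by (auto simp: finsum_rdistr intro!: finsum_cong')
qed

lemma residue_bracket_triangle:
  assumes "distinct_residues n [i, j, k]"
  shows "residue_bracket i j \<otimes> residue_bracket j k =
    residue_bracket j k \<otimes> residue_bracket i k \<oplus> residue_bracket i k \<otimes> residue_bracket i j"
proof -
  let ?A = "residue_window n (2 * N) i j" and ?B = "residue_window n (2 * N) i k"
  have "residue_bracket i j \<otimes> residue_bracket j k = (\<Oplus>k'\<in>?B. \<Oplus>j'\<in>?A. b i j' \<otimes> b j' k')"
    unfolding residue_bracket_product_row by (rule finsum_swap) simp_all
  also have "\<dots> = (\<Oplus>k'\<in>?B. \<Oplus>j'\<in>?A. b j' k' \<otimes> b i k' \<oplus> b i k' \<otimes> b i j')"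
    using assms by (intro finsum_cong' refl b_triangle)
      (auto simp: residue_window_def distinct_residues_def)
  also have "\<dots> = (\<Oplus>k'\<in>?B. \<Oplus>j'\<in>?A. b j' k' \<otimes> b i k') \<oplus> (\<Oplus>k'\<in>?B. \<Oplus>j'\<in>?A. b i k' \<otimes> b i j')"
    by (simp add: finsum_addf)
  also have "(\<Oplus>k'\<in>?B. \<Oplus>j'\<in>?A. b j' k' \<otimes> b i k') = residue_bracket j k \<otimes> residue_bracket i k"
    by (rule residue_bracket_product_column[symmetric])
  also have "(\<Oplus>k'\<in>?B. \<Oplus>j'\<in>?A. b i k' \<otimes> b i j') = residue_bracket i k \<otimes> residue_bracket i j"
    by (simp add: finsum_product residue_bracket_row[of i i "2 * N"])
  finally show ?thesis .
qed

lemma finsum_residue_brackets: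
  assumes "i \<in> {1..int n}"
  shows "(\<Oplus>j\<in>{1..int n} - {i}. residue_bracket i j) =
    (\<Oplus>j\<in>{j. distinct_residues n [i, j] \<and> \<bar>j - i\<bar> < int N}. b i j)"
proof -
  have "{j. distinct_residues n [i, j] \<and> \<bar>j - i\<bar> < int N} =
      (\<Union>j\<in>{1..int n} - {i}. residue_window n N i j)" (is "?L = ?R")
  proof (intro equalityI subsetI)
    fix j assume "j \<in> ?L"
    moreover obtain j0 where "j0 \<in> {1..int n}" "j0 mod int n = j mod int n"
      using residue_representative[OF n_pos] .
    ultimately show "j \<in> ?R"
      by (intro UN_I[of j0]) (auto simp: residue_window_def distinct_residues_def)
  next
    fix j assume "j \<in> ?R"
    then show "j \<in> ?L"
      using assms distinct_residues_iff_distinct[of "[i, _]"]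
      by (auto simp: residue_window_def distinct_residues_def)
  qed
  moreover have "(\<Oplus>j\<in>?R. b i j) = (\<Oplus>j\<in>{1..int n} - {i}. residue_bracket i j)"
    unfolding residue_bracket_def
  proof (rule add.finprod_UN_disjoint)
    show "pairwise (\<lambda>j k. disjnt (residue_window n N i j) (residue_window n N i k))
        ({1..int n} - {i})"
    proof (rule pairwiseI)
      fix j k assume "j \<in> {1..int n} - {i}" "k \<in> {1..int n} - {i}" "j \<noteq> k"
      then show "disjnt (residue_window n N i j) (residue_window n N i k)"
        using distinct_residues_iff_distinct[of "[j, k]" n]
        by (auto simp: disjnt_iff residue_window_def distinct_residues_def)
    qed
  qed simp_all
  ultimately show ?thesis by simp
qed

theorem affine_dunkl_power_sum:
  fixes m :: nat
  assumes "m \<ge> 1"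
  shows "(\<Oplus>i\<in>{1..int n}. (\<Oplus>j\<in>{j. distinct_residues n [i, j] \<and> \<bar>j - i\<bar> < int N}. b i j) [^] m) = \<zero>"
proof -
  interpret FK_ring R "{1..int n}" residue_bracket
  proof
    fix i j k l
    let ?V = "{1..int n}"
    show "residue_bracket j i = \<ominus> residue_bracket i j"
      by (rule residue_bracket_anti)
    show "residue_bracket i j \<otimes> residue_bracket i j = \<zero>" if "i \<in> ?V" "j \<in> ?V" "i \<noteq> j"
      using that distinct_residues_iff_distinct[of "[i, j]"] by (auto intro: residue_bracket_square)
    show "residue_bracket i j \<otimes> residue_bracket k l = residue_bracket k l \<otimes> residue_bracket i j"
      if "{i, j, k, l} \<subseteq> ?V" "distinct [i, j, k, l]"
      using that distinct_residues_iff_distinct[of "[i, j, k, l]"] by (intro residue_bracket_commute) auto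
    show "residue_bracket i j \<otimes> residue_bracket j k =
        residue_bracket j k \<otimes> residue_bracket i k \<oplus> residue_bracket i k \<otimes> residue_bracket i j"
      if "{i, j, k} \<subseteq> ?V" "distinct [i, j, k]"
      using that distinct_residues_iff_distinct[of "[i, j, k]"] by (intro residue_bracket_triangle) auto
  qed simp_all
  have "(\<Oplus>i\<in>{1..int n}. (\<Oplus>j\<in>{j. distinct_residues n [i, j] \<and> \<bar>j - i\<bar> < int N}. b i j) [^] m) =
      (\<Oplus>i\<in>{1..int n}. (\<Oplus>j\<in>{1..int n} - {i}. residue_bracket i j) [^] m)"
    by (intro finsum_cong') (simp_all add: finsum_residue_brackets)
  also have "\<dots> = \<zero>"
    using assms by (rule dunkl_power_sum)
  finally show ?thesis .
qed

end

section \<open>Finiteness in the affine symmetric group\<close>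

lemma word_product_Nil [simp]: "word_product n [] = id"
  by (simp add: word_product_def)

lemma word_product_Cons [simp]:
  "word_product n (k # ks) = reflection n (int k) (int k + 1) \<circ> word_product n ks"
  by (simp add: word_product_def)

lemma word_product_append: "word_product n (ks @ ls) = word_product n ks \<circ> word_product n ls"
  by (induction ks) (simp_all add: comp_assoc)

lemma affine_sym_comp: "v \<in> affine_sym n \<Longrightarrow> w \<in> affine_sym n \<Longrightarrow> v \<circ> w \<in> affine_sym n"
  unfolding affine_sym_def
  by (auto simp: word_product_append[symmetric] simp del: in_lists_conv_set intro!: imageI)

lemma reflection_involution:
  assumes "distinct_residues n [i, j]"
  shows "reflection n i j (reflection n i j k) = k"
proof -
  have "(k + (j - i)) mod int n = j mod int n" if "k mod int n = i mod int n" for i j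
    using that by (metis mod_add_left_eq add_diff_cancel_left' diff_add_eq add_diff_eq)
  then show ?thesis
    using assms by (simp add: reflection_def distinct_residues_def)
qed

lemma distinct_residues_Suc: "n \<ge> 2 \<Longrightarrow> distinct_residues n [i, i + 1]"
  by (auto simp: distinct_residues_def mod_eq_dvd_iff)

lemma simple_reflection_affine_sym:
  assumes "n \<ge> 2"
  shows "reflection n i (i + 1) \<in> affine_sym n"
proof -
  define k where "k = nat (i mod int n)"
  have k: "int k = i mod int n" "k < n" using assms by (auto simp: k_def nat_less_iff)
  have "reflection n i (i + 1) = reflection n (int k) (int k + 1)"
    by (auto simp: reflection_def fun_eq_iff k mod_simps)
  also have "\<dots> = word_product n [k]" by simp
  finally show ?thesis
    unfolding affine_sym_def using k(2) by (intro image_eqI[of _ _ "[k]"]) auto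
qed

lemma affine_sym_induct [consumes 2, case_names id simple_reflection]:
  assumes "n \<ge> 2" "w \<in> affine_sym n" "P id"
    and "\<And>k w. P w \<Longrightarrow> P (reflection n k (k + 1) \<circ> w)"
  shows "P w"
proof -
  have "P (word_product n ks)" for ks
    using assms(3,4) by (induction ks) simp_all
  then show ?thesis
    using assms(2) by (auto simp: affine_sym_def)
qed

lemma inj_affine_sym:
  assumes "n \<ge> 2" "w \<in> affine_sym n"
  shows "inj w"
  using assms
proof (induction rule: affine_sym_induct)
  case (simple_reflection k w)
  have "inj (reflection n k (k + 1))"
    using assms(1) by (metis distinct_residues_Suc injI reflection_involution)
  then show ?case
    using simple_reflection by (rule inj_compose)
qed simp

lemma affine_sym_diff:
  assumes "n \<ge> 2" "w \<in> affine_sym n" "i mod int n = j mod int n"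
  shows "w i - w j = i - j"
  using assms(1,2)
proof (induction rule: affine_sym_induct)
  case (simple_reflection k w)
  then have "w i mod int n = w j mod int n"
    using assms(3) by (simp add: mod_eq_dvd_iff)
  then show ?case
    using simple_reflection by (simp add: reflection_def)
qed simp

lemma affine_sym_mod_eq_iff:
  assumes "n \<ge> 2" "w \<in> affine_sym n"
  shows "w i mod int n = w j mod int n \<longleftrightarrow> i mod int n = j mod int n"
proof
  assume "w i mod int n = w j mod int n"
  then obtain q where q: "w i = w j + int n * q"
    by (metis mod_eq_dvd_iff dvdE diff_eq_eq add.commute)
  have "w (j + int n * q) - w j = int n * q"
    using affine_sym_diff[OF assms, of "j + int n * q" j] by simp
  then have "w i = w (j + int n * q)" using q by simp
  then have "i = j + int n * q"
    using inj_affine_sym[OF assms] by (simp add: inj_eq)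
  then show "i mod int n = j mod int n" by simp
next
  assume "i mod int n = j mod int n"
  then show "w i mod int n = w j mod int n"
    using affine_sym_diff[OF assms, of i j] by (simp add: mod_eq_dvd_iff)
qed

lemma affine_sym_comp_reflection:
  assumes "n \<ge> 2" "w \<in> affine_sym n"
  shows "w \<circ> reflection n i j = reflection n (w i) (w j) \<circ> w"
proof
  fix a
  have "w (a + (k - l)) = w a + (w k - w l)" if "a mod int n = l mod int n" for k l
  proof -
    have "(a + (k - l)) mod int n = k mod int n"
      using that by (simp add: mod_eq_dvd_iff)
    then show ?thesis
      using affine_sym_diff[OF assms, of "a + (k - l)" k] affine_sym_diff[OF assms that] by simp
  qed
  then show "(w \<circ> reflection n i j) a = (reflection n (w i) (w j) \<circ> w) a"
    by (simp add: reflection_def affine_sym_mod_eq_iff[OF assms])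
qed

lemma reflection_conj_simple:
  assumes "n \<ge> 2" "reflection n i j \<in> affine_sym n"
  shows "reflection n (reflection n k (k + 1) i) (reflection n k (k + 1) j) \<in> affine_sym n"
proof -
  let ?s = "reflection n k (k + 1)"
  have "?s \<circ> ?s = id"
    using distinct_residues_Suc[OF assms(1)] by (simp add: fun_eq_iff reflection_involution)
  then have "reflection n (?s i) (?s j) = ?s \<circ> reflection n i j \<circ> ?s"
    using affine_sym_comp_reflection[OF assms(1) simple_reflection_affine_sym[OF assms(1)]]
    by (simp add: comp_assoc)
  then show ?thesis
    using assms simple_reflection_affine_sym by (simp add: affine_sym_comp)
qed

lemma reflection_affine_sym:
  assumes "n \<ge> 2"
  shows "i < j \<Longrightarrow> distinct_residues n [i, j] \<Longrightarrow> reflection n i j \<in> affine_sym n"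
proof (induction "nat (j - i)" arbitrary: i j rule: less_induct)
  case less
  have adjacent: "k mod int n \<noteq> (k + 1) mod int n" for k
    using distinct_residues_Suc[OF assms, of k] by (simp add: distinct_residues_def)
  consider (simple) "j = i + 1" | (apart) "j \<noteq> i + 1" "i mod int n \<noteq> (j - 1) mod int n"
    | (congruent) "j \<noteq> i + 1" "i mod int n = (j - 1) mod int n" by blast
  then show ?case
  proof cases
    case simple
    then show ?thesis using simple_reflection_affine_sym[OF assms] by simp
  next
    case apart
    then have "reflection n i (j - 1) \<in> affine_sym n"
      using less.prems by (intro less.hyps) (auto simp: distinct_residues_def)
    from reflection_conj_simple[OF assms this, of "j - 1"] show ?thesis
      using apart less.prems by (simp add: reflection_def distinct_residues_def)
  next
    case congruent
    then have "int n dvd j - 1 - i"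
      by (metis mod_eq_dvd_iff)
    then have "int n \<le> j - 1 - i"
      using congruent less.prems by (intro zdvd_imp_le) auto
    moreover have "j mod int n = (i + 1) mod int n"
      using congruent(2) by (metis mod_add_left_eq diff_add_cancel)
    ultimately have "reflection n (i + 1) (j - 1) \<in> affine_sym n"
      using less.prems adjacent[of i] congruent(2) assms
      by (intro less.hyps) (auto simp: distinct_residues_def)
    from reflection_conj_simple[OF assms this, of i] show ?thesis
      using congruent(2) adjacent[of i] by (simp add: reflection_def)
  qed
qed

lemma finite_bounded_length: "finite {v \<in> affine_sym n. aff_length n v \<le> l}"
proof (rule finite_subset)
  show "{v \<in> affine_sym n. aff_length n v \<le> l}
      \<subseteq> word_product n ` {ks. set ks \<subseteq> {..<n} \<and> length ks \<le> l}"
  proof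
    fix v assume v: "v \<in> {v \<in> affine_sym n. aff_length n v \<le> l}"
    then have "\<exists>k. \<exists>ks\<in>lists {..<n}. length ks = k \<and> word_product n ks = v"
      by (auto simp: affine_sym_def)
    then have "\<exists>ks\<in>lists {..<n}. length ks = aff_length n v \<and> word_product n ks = v"
      unfolding aff_length_def by (rule LeastI_ex)
    then show "v \<in> word_product n ` {ks. set ks \<subseteq> {..<n} \<and> length ks \<le> l}"
      using v by (auto simp: in_lists_conv_set)
  qed
  show "finite (word_product n ` {ks. set ks \<subseteq> {..<n} \<and> length ks \<le> l})"
    by (intro finite_imageI finite_lists_length_le) simp
qed

lemma act_letter_eq_Some_iff:
  "act_letter n w a = Some v \<longleftrightarrow>
    v = w \<circ> reflection n (fst a) (snd a) \<and> aff_length n w = aff_length n v + 1"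
  by (auto simp: act_letter_def Let_def)

lemma act_letter_affine_sym:
  assumes "n \<ge> 2" "w \<in> affine_sym n" "a \<in> symbols n" "act_letter n w a = Some v"
  shows "v \<in> affine_sym n"
proof -
  have "reflection n (fst a) (snd a) \<in> affine_sym n"
    using assms(1,3) by (intro reflection_affine_sym) (auto simp: symbols_def)
  then show ?thesis
    using assms(2,4) by (auto simp: act_letter_eq_Some_iff intro: affine_sym_comp)
qed

lemma act_word_affine_sym:
  assumes "n \<ge> 2"
  shows "w \<in> affine_sym n \<Longrightarrow> u \<in> lists (symbols n) \<Longrightarrow> act_word n w u = Some v \<Longrightarrow> v \<in> affine_sym n"
  by (induction u arbitrary: w)
    (auto simp: bind_eq_Some_conv intro: act_letter_affine_sym[OF assms])

lemma act_word_append: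
  "act_word n w (u @ v) = Option.bind (act_word n w u) (\<lambda>w'. act_word n w' v)"
  by (induction u arbitrary: w) auto

definition letters_at :: "nat \<Rightarrow> int \<Rightarrow> letter set" where
  "letters_at n i = {a \<in> symbols n. fst a = i \<or> snd a = i}"

lemma min_max_in_letters_at:
  "distinct_residues n [i, j] \<Longrightarrow> (min i j, max i j) \<in> letters_at n i"
  by (cases i j rule: linorder_cases) (auto simp: letters_at_def symbols_def distinct_residues_def)

text \<open>The image of \<open>A\<^sub>w\<close> under \<open>[ij]\<close> determines \<open>j\<close>, and there are finitely many candidates
  for it since its length is bounded.\<close>

lemma finite_act_letters_at:
  assumes "n \<ge> 2" "w \<in> affine_sym n"
  shows "finite {a \<in> letters_at n i. act_letter n w a \<noteq> None}"
proof (rule finite_subset)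
  let ?F = "{v \<in> affine_sym n. aff_length n v \<le> aff_length n w}"
  let ?letter = "\<lambda>v. (min i (the_inv w (v i)), max i (the_inv w (v i)))"
  show "{a \<in> letters_at n i. act_letter n w a \<noteq> None} \<subseteq> ?letter ` ?F"
  proof
    fix a assume "a \<in> {a \<in> letters_at n i. act_letter n w a \<noteq> None}"
    then obtain v where a: "a \<in> letters_at n i" and v: "act_letter n w a = Some v"
      by auto
    have "the_inv w (v i) = reflection n (fst a) (snd a) i"
      using v inj_affine_sym[OF assms] by (simp add: act_letter_eq_Some_iff the_inv_f_f)
    also have "\<dots> = (if fst a = i then snd a else fst a)"
      using a by (auto simp: letters_at_def symbols_def reflection_def distinct_residues_def)
    finally have "a = ?letter v"
      using a by (auto simp: letters_at_def symbols_def)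
    moreover have "v \<in> affine_sym n"
      using a v by (intro act_letter_affine_sym[OF assms]) (auto simp: letters_at_def)
    ultimately show "a \<in> ?letter ` ?F"
      using v by (auto simp: act_letter_eq_Some_iff)
  qed
  show "finite (?letter ` ?F)" by (intro finite_imageI finite_bounded_length)
qed

definition words_at :: "nat \<Rightarrow> int list \<Rightarrow> letter list set" where
  "words_at n ks = {u. list_all2 (\<lambda>a i. a \<in> letters_at n i) u ks}"

lemma words_at_subset: "words_at n ks \<subseteq> lists (symbols n)"
proof
  fix u assume "u \<in> words_at n ks"
  then have "list_all2 (\<lambda>a i. a \<in> letters_at n i) u ks"
    by (simp add: words_at_def)
  then show "u \<in> lists (symbols n)"
    by (induction rule: list_all2_induct) (simp_all add: letters_at_def)
qed

lemma length_words_at: "u \<in> words_at n ks \<Longrightarrow> length u = length ks"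
  by (auto simp: words_at_def dest: list_all2_lengthD)

lemma finite_act_words_at:
  assumes "n \<ge> 2" "w \<in> affine_sym n"
  shows "finite {u \<in> words_at n ks. act_word n w u \<noteq> None}"
  using assms(2)
proof (induction ks arbitrary: w)
  case Nil
  then show ?case by (simp add: words_at_def)
next
  case (Cons i ks)
  let ?A = "{a \<in> letters_at n i. act_letter n w a \<noteq> None}"
  let ?U = "\<lambda>a. {u \<in> words_at n ks. act_word n (the (act_letter n w a)) u \<noteq> None}"
  have "{u \<in> words_at n (i # ks). act_word n w u \<noteq> None} \<subseteq> (\<lambda>(a, u). a # u) ` (SIGMA a:?A. ?U a)"
    by (fastforce simp: words_at_def list_all2_Cons2 bind_eq_Some_conv)
  moreover have "finite (?U a)" if "a \<in> ?A" for a
    using that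
    by (intro Cons.IH)
      (auto simp: letters_at_def intro: act_letter_affine_sym[OF assms(1) Cons.prems])
  then have "finite ((\<lambda>(a, u). a # u) ` (SIGMA a:?A. ?U a))"
    by (intro finite_imageI finite_SigmaI finite_act_letters_at[OF assms(1) Cons.prems])
  ultimately show ?case by (rule finite_subset)
qed

section \<open>The algebra of series with finite action\<close>

lemma ser_mult_Nil: "ser_mult f g [] = f [] * g []"
  by (simp add: ser_mult_def)

lemma ser_mult_Cons: "ser_mult f g (a # u) = f [] * g (a # u) + ser_mult (\<lambda>v. f (a # v)) g u"
  by (simp add: ser_mult_def sum.atMost_Suc_shift del: sum.atMost_Suc)

lemma ser_mult_scale_left: "ser_mult (\<lambda>v. c * f v) g u = c * ser_mult f g u"
  by (simp add: ser_mult_def sum_distrib_left mult.assoc)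

lemma ser_mult_add_left: "ser_mult (ser_add f g) h u = ser_mult f h u + ser_mult g h u"
  by (simp add: ser_mult_def sum.distrib distrib_right)

lemma ser_mult_add_right: "ser_mult f (ser_add g h) u = ser_mult f g u + ser_mult f h u"
  by (simp add: ser_mult_def sum.distrib distrib_left)

lemma ser_mult_assoc: "ser_mult (ser_mult f g) h u = ser_mult f (ser_mult g h) u"
proof (induction u arbitrary: f)
  case Nil
  then show ?case by (simp add: ser_mult_Nil mult.assoc)
next
  case (Cons a u)
  have "(\<lambda>v. ser_mult f g (a # v)) = ser_add (\<lambda>v. f [] * g (a # v)) (ser_mult (\<lambda>v. f (a # v)) g)"
    by (simp add: ser_mult_Cons)
  then have "ser_mult (\<lambda>v. ser_mult f g (a # v)) h u =
      f [] * ser_mult (\<lambda>v. g (a # v)) h u + ser_mult (ser_mult (\<lambda>v. f (a # v)) g) h u"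
    by (simp only: ser_mult_add_left ser_mult_scale_left)
  then show ?case
    by (simp add: ser_mult_Cons[of "ser_mult f g"] ser_mult_Cons[of f "ser_mult g h"]
        ser_mult_Cons[of g h] ser_mult_Nil Cons algebra_simps)
qed

lemma ser_mult_one_left: "ser_mult (monomial []) f u = f u"
proof -
  have "ser_mult (\<lambda>v. 0) f u = (0 :: 'a)" for u by (simp add: ser_mult_def)
  then show ?thesis by (cases u) (simp_all add: ser_mult_Nil ser_mult_Cons monomial_def)
qed

lemma ser_mult_one_right: "ser_mult f (monomial []) u = f u"
  by (induction u arbitrary: f) (simp_all add: ser_mult_Nil ser_mult_Cons monomial_def)

lemma ser_mult_nonzero:
  assumes "ser_mult f g u \<noteq> 0"
  obtains v w where "u = v @ w" "f v \<noteq> 0" "g w \<noteq> 0"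
proof -
  from assms obtain k where "f (take k u) * g (drop k u) \<noteq> 0"
    unfolding ser_mult_def by (meson sum.not_neutral_contains_not_neutral)
  then show ?thesis by (intro that[of "take k u" "drop k u"]) auto
qed

lemma ser_sum_nonzero:
  assumes "ser_sum I F u \<noteq> 0"
  obtains a where "a \<in> I" "F a u \<noteq> 0"
proof -
  from assms have "{a. (if a \<in> I then F a u else 0) \<noteq> 0} \<noteq> {}"
    unfolding ser_sum_def Sum_any.expand_set by (metis sum.empty)
  then show ?thesis using that by (auto split: if_splits)
qed

lemma ser_sum_eq_sum:
  assumes "finite A" "A \<subseteq> I" "\<And>a. a \<in> I - A \<Longrightarrow> F a u = 0"
  shows "ser_sum I F u = (\<Sum>a\<in>A. F a u)"
proof -
  have "ser_sum I F u = (\<Sum>a\<in>A. if a \<in> I then F a u else 0)"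
    unfolding ser_sum_def using assms by (intro Sum_any.expand_superset) (auto split: if_splits)
  also have "\<dots> = (\<Sum>a\<in>A. F a u)" using assms(2) by (intro sum.cong) auto
  finally show ?thesis .
qed

lemma br_nonzero: "br i j u \<noteq> 0 \<Longrightarrow> u = [(min i j, max i j)]"
  by (auto simp: br_def monomial_def split: if_splits)

lemma br_swap: "i \<noteq> j \<Longrightarrow> br j i = (\<lambda>u. - br i j u)"
  by (cases i j rule: linorder_cases) (simp_all add: br_def)

definition small_word :: "nat \<Rightarrow> letter list \<Rightarrow> bool" where
  "small_word N u \<longleftrightarrow> (\<forall>(i, j)\<in>set u. \<bar>i\<bar> < int N \<and> \<bar>j\<bar> < int N)"

lemma small_word_append [simp]: "small_word N (u @ v) \<longleftrightarrow> small_word N u \<and> small_word N v"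
  by (auto simp: small_word_def)

lemma index_filt_iff: "f \<in> index_filt N \<longleftrightarrow> (\<forall>u. small_word N u \<longrightarrow> f u = 0)"
proof -
  have "small_word N u \<longleftrightarrow> \<not> (\<exists>(i, j)\<in>set u. int N \<le> \<bar>i\<bar> \<or> int N \<le> \<bar>j\<bar>)" for u
    by (auto simp: small_word_def case_prod_beta not_le)
  then show ?thesis unfolding index_filt_def by blast
qed

lemma finite_small_words: "finite {u. small_word N u \<and> length u \<le> l}"
proof (rule finite_subset)
  let ?letters = "{- int N..int N} \<times> {- int N..int N}"
  show "{u. small_word N u \<and> length u \<le> l} \<subseteq> {u. set u \<subseteq> ?letters \<and> length u \<le> l}"
    by (fastforce simp: small_word_def)
  show "finite {u. set u \<subseteq> ?letters \<and> length u \<le> l}"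
    by (intro finite_lists_length_le) simp
qed

lemma completed_alg_iff:
  "f \<in> completed_alg n \<longleftrightarrow>
    {u. f u \<noteq> 0} \<subseteq> lists (symbols n) \<and> (\<forall>N. finite {u. f u \<noteq> 0 \<and> small_word N u})"
proof (intro iffI conjI allI)
  assume f: "f \<in> completed_alg n"
  then show "{u. f u \<noteq> 0} \<subseteq> lists (symbols n)"
    by (simp add: completed_alg_def)
  fix N
  obtain p where p: "p \<in> free_alg n" "ser_diff f p \<in> index_filt N"
    using f unfolding completed_alg_def by blast
  then have "{u. f u \<noteq> 0 \<and> small_word N u} \<subseteq> {u. p u \<noteq> 0}"
    by (auto simp: index_filt_iff)
  then show "finite {u. f u \<noteq> 0 \<and> small_word N u}"
    using p(1) finite_subset by (auto simp: free_alg_def)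
next
  assume f: "{u. f u \<noteq> 0} \<subseteq> lists (symbols n) \<and> (\<forall>N. finite {u. f u \<noteq> 0 \<and> small_word N u})"
  have "\<exists>p\<in>free_alg n. ser_diff f p \<in> index_filt N" for N
  proof
    let ?p = "\<lambda>u. if small_word N u then f u else 0"
    have "{u. ?p u \<noteq> 0} = {u. f u \<noteq> 0 \<and> small_word N u}" by auto
    then show "?p \<in> free_alg n" using f by (auto simp: free_alg_def)
    show "ser_diff f ?p \<in> index_filt N" by (simp add: index_filt_iff)
  qed
  then show "f \<in> completed_alg n" using f by (simp add: completed_alg_def)
qed

lemma finite_action_iff:
  "f \<in> finite_action n \<longleftrightarrow> {u. f u \<noteq> 0} \<subseteq> lists (symbols n) \<and>
    (\<forall>N. finite {u. f u \<noteq> 0 \<and> small_word N u}) \<and>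
    (\<forall>w\<in>affine_sym n. finite {u. f u \<noteq> 0 \<and> act_word n w u \<noteq> None})"
  by (auto simp: finite_action_def completed_alg_iff)

lemma finite_action_words_at:
  assumes "n \<ge> 2" and supp: "\<And>u. f u \<noteq> 0 \<Longrightarrow> u \<in> words_at n ks"
  shows "f \<in> finite_action n"
  unfolding finite_action_iff
proof (intro conjI allI ballI)
  show "{u. f u \<noteq> 0} \<subseteq> lists (symbols n)"
    using supp words_at_subset by blast
  show "finite {u. f u \<noteq> 0 \<and> small_word N u}" for N
    by (rule finite_subset[OF _ finite_small_words[of N "length ks"]])
      (auto dest!: supp length_words_at)
  show "finite {u. f u \<noteq> 0 \<and> act_word n w u \<noteq> None}" if "w \<in> affine_sym n" for w
    by (rule finite_subset[OF _ finite_act_words_at[OF assms(1) that, of ks]]) (auto dest: supp)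
qed

lemma finite_action_zero: "(\<lambda>_. 0) \<in> finite_action n"
  by (simp add: finite_action_iff)

lemma finite_action_diff:
  assumes "f \<in> finite_action n" "g \<in> finite_action n"
  shows "ser_diff f g \<in> finite_action n"
proof -
  have finite_diff: "finite {u. f u - g u \<noteq> 0 \<and> P u}"
    if "finite {u. f u \<noteq> 0 \<and> P u}" "finite {u. g u \<noteq> 0 \<and> P u}" for P
    by (rule finite_subset[OF _ finite_UnI[OF that]]) auto
  have "{u. f u - g u \<noteq> 0} \<subseteq> {u. f u \<noteq> 0} \<union> {u. g u \<noteq> 0}"
    by auto
  also have "\<dots> \<subseteq> lists (symbols n)"
    using assms by (simp add: finite_action_iff)
  finally show ?thesis
    unfolding finite_action_iff using assms
    by (intro conjI allI ballI finite_diff) (simp_all add: finite_action_iff)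
qed

lemma finite_action_add:
  assumes "f \<in> finite_action n" "g \<in> finite_action n"
  shows "ser_add f g \<in> finite_action n"
  using finite_action_diff[OF assms(1) finite_action_diff[OF finite_action_zero assms(2)]] by simp

lemma finite_support_ser_mult:
  assumes "finite {u. f u \<noteq> 0 \<and> P u}" "\<And>u. f u \<noteq> 0 \<Longrightarrow> P u \<Longrightarrow> finite {v. g v \<noteq> 0 \<and> Q u v}"
    and append: "\<And>u v. R (u @ v) \<Longrightarrow> P u \<and> Q u v"
  shows "finite {w. ser_mult f g w \<noteq> 0 \<and> R w}"
proof (rule finite_subset)
  let ?pairs = "SIGMA u:{u. f u \<noteq> 0 \<and> P u}. {v. g v \<noteq> 0 \<and> Q u v}"
  show "{w. ser_mult f g w \<noteq> 0 \<and> R w} \<subseteq> (\<lambda>(u, v). u @ v) ` ?pairs"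
    using append by (force elim!: ser_mult_nonzero)
  show "finite ((\<lambda>(u, v). u @ v) ` ?pairs)"
    using assms(1,2) by auto
qed

lemma finite_action_mult:
  assumes "n \<ge> 2" and f: "f \<in> finite_action n" and g: "g \<in> finite_action n"
  shows "ser_mult f g \<in> finite_action n"
  unfolding finite_action_iff
proof (intro conjI allI ballI)
  show "{u. ser_mult f g u \<noteq> 0} \<subseteq> lists (symbols n)"
    using f g by (fastforce simp: finite_action_iff elim!: ser_mult_nonzero)
  show "finite {u. ser_mult f g u \<noteq> 0 \<and> small_word N u}" for N
    using f g
    by (intro finite_support_ser_mult[where P = "small_word N" and Q = "\<lambda>_. small_word N"])
      (simp_all add: finite_action_iff)
  fix w assume w: "w \<in> affine_sym n"
  show "finite {u. ser_mult f g u \<noteq> 0 \<and> act_word n w u \<noteq> None}"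
  proof (rule finite_support_ser_mult)
    show "finite {u. f u \<noteq> 0 \<and> act_word n w u \<noteq> None}"
      using f w by (simp add: finite_action_iff)
    show "finite {v. g v \<noteq> 0 \<and> act_word n (the (act_word n w u)) v \<noteq> None}"
      if "f u \<noteq> 0" "act_word n w u \<noteq> None" for u
    proof -
      have "u \<in> lists (symbols n)"
        using f that(1) by (auto simp: finite_action_iff)
      then have "the (act_word n w u) \<in> affine_sym n"
        using act_word_affine_sym[OF assms(1) w] that(2) by auto
      then show ?thesis
        using g by (simp add: finite_action_iff)
    qed
  qed (auto simp: act_word_append bind_eq_Some_conv)
qed

lemma finite_action_one: "n \<ge> 2 \<Longrightarrow> monomial [] \<in> finite_action n"
  by (rule finite_action_words_at[where ks = "[]"])
    (auto simp: monomial_def words_at_def split: if_splits)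

lemma br_in_words_at: "distinct_residues n [i, j] \<Longrightarrow> br i j u \<noteq> 0 \<Longrightarrow> u \<in> words_at n [i]"
  by (auto simp: words_at_def min_max_in_letters_at dest: br_nonzero)

lemma ser_mult_br_in_words_at:
  assumes "distinct_residues n [i, j]" "distinct_residues n [k, l]"
    and "ser_mult (br i j) (br k l) u \<noteq> 0"
  shows "u \<in> words_at n [i, k]"
  using assms
  by (auto simp: words_at_def min_max_in_letters_at elim!: ser_mult_nonzero dest!: br_nonzero)

lemma finite_action_br: "n \<ge> 2 \<Longrightarrow> distinct_residues n [i, j] \<Longrightarrow> br i j \<in> finite_action n"
  by (rule finite_action_words_at[OF _ br_in_words_at])

lemma finite_action_dunkl:
  assumes "n \<ge> 2"
  shows "dunkl n i \<in> finite_action n"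
  unfolding dunkl_def
  by (rule finite_action_words_at[OF assms, where ks = "[i]"])
    (auto elim!: ser_sum_nonzero intro: br_in_words_at)

lemma finite_action_residue_sum:
  assumes "n \<ge> 2" "distinct_residues n [i, j]"
  shows "ser_sum {(i', j'). i' mod int n = i mod int n \<and> j' mod int n = j mod int n}
    (\<lambda>(i', j'). ser_mult (br i j') (br j i')) \<in> finite_action n"
proof (rule finite_action_words_at[OF assms(1), where ks = "[i, j]"], elim ser_sum_nonzero, clarify)
  fix u and i' j' :: int
  assume "i' mod int n = i mod int n" "j' mod int n = j mod int n"
    and "ser_mult (br i j') (br j i') u \<noteq> (0 :: 'a)"
  then show "u \<in> words_at n [i, j]"
    using assms(2) by (intro ser_mult_br_in_words_at) (auto simp: distinct_residues_def)
qed

lemma relators_finite_action: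
  assumes "n \<ge> 2"
  shows "relators c n \<subseteq> finite_action n"
proof
  fix f assume "f \<in> relators c n"
  then show "f \<in> finite_action n"
  proof cases
    case (residue_sum i j)
    then show ?thesis using finite_action_residue_sum[OF assms] by simp
  qed (cases c; auto intro!: finite_action_diff finite_action_add finite_action_mult[OF assms]
      finite_action_br[OF assms] simp: distinct_residues_def)+
qed

lemma E_alg_simps [simp]:
  "carrier (E_alg n) = finite_action n"
  "f \<oplus>\<^bsub>E_alg n\<^esub> g = ser_add f g"
  "f \<otimes>\<^bsub>E_alg n\<^esub> g = ser_mult f g"
  "\<zero>\<^bsub>E_alg n\<^esub> = (\<lambda>_. 0)"
  "\<one>\<^bsub>E_alg n\<^esub> = monomial []"
  by (simp_all add: E_alg_def)

lemma ring_E_alg: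
  assumes "n \<ge> 2"
  shows "ring (E_alg n :: 'k::comm_ring_1 series ring)"
proof (rule ringI)
  show "abelian_group (E_alg n :: 'k series ring)"
  proof (rule abelian_groupI)
    fix f :: "'k series" assume "f \<in> carrier (E_alg n)"
    then show "\<exists>g\<in>carrier (E_alg n). g \<oplus>\<^bsub>E_alg n\<^esub> f = \<zero>\<^bsub>E_alg n\<^esub>"
      using finite_action_diff[OF finite_action_zero]
      by (intro bexI[of _ "\<lambda>u. 0 - f u"]) auto
  qed (simp_all add: finite_action_add finite_action_zero add_ac)
  show "Group.monoid (E_alg n :: 'k series ring)"
    by (rule Group.monoidI)
      (simp_all add: finite_action_mult finite_action_one ser_mult_assoc ser_mult_one_left
        ser_mult_one_right assms fun_eq_iff)
qed (simp_all add: ser_mult_add_left ser_mult_add_right fun_eq_iff)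

lemma E_alg_a_inv:
  fixes f :: "'k::comm_ring_1 series"
  assumes "n \<ge> 2" "f \<in> finite_action n"
  shows "\<ominus>\<^bsub>E_alg n\<^esub> f = (\<lambda>u. - f u)"
proof -
  interpret ring "E_alg n :: 'k series ring" by (rule ring_E_alg[OF assms(1)])
  show ?thesis
    using finite_action_diff[OF finite_action_zero assms(2)] assms(2)
    by (intro minus_equality) auto
qed

lemma E_alg_minus:
  assumes "n \<ge> 2" "g \<in> finite_action n"
  shows "f \<ominus>\<^bsub>E_alg n\<^esub> g = ser_diff f g"
  using assms by (simp add: a_minus_def E_alg_a_inv)

lemma finsum_E_alg:
  fixes F :: "'b \<Rightarrow> 'k::comm_ring_1 series"
  assumes "n \<ge> 2" "finite A" "F \<in> A \<rightarrow> finite_action n"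
  shows "(\<Oplus>\<^bsub>E_alg n\<^esub>a\<in>A. F a) = (\<lambda>u. \<Sum>a\<in>A. F a u)"
proof -
  interpret ring "E_alg n :: 'k series ring" by (rule ring_E_alg[OF assms(1)])
  show ?thesis
    using assms(2,3) by (induction A rule: finite_induct) (simp_all add: Pi_def)
qed

section \<open>The truncated quotients\<close>

lemma (in ideal) rcos_power_sum_eq_zero_iff:
  fixes m :: nat
  assumes "\<theta> \<in> A \<rightarrow> carrier R"
  shows "(\<Oplus>\<^bsub>R Quot I\<^esub>a\<in>A. (I +> \<theta> a) [^]\<^bsub>R Quot I\<^esub> m) = \<zero>\<^bsub>R Quot I\<^esub> \<longleftrightarrow>
    (\<Oplus>a\<in>A. \<theta> a [^] m) \<in> I"
proof -
  interpret hom: ring_hom_ring R "R Quot I" "(+>) I"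
    by (rule rcos_ring_hom_ring)
  have power_sum_closed: "(\<Oplus>a\<in>A. \<theta> a [^] m) \<in> carrier R"
    using assms by (intro finsum_closed) auto
  have "(\<Oplus>\<^bsub>R Quot I\<^esub>a\<in>A. (I +> \<theta> a) [^]\<^bsub>R Quot I\<^esub> m) = (\<Oplus>\<^bsub>R Quot I\<^esub>a\<in>A. I +> \<theta> a [^] m)"
    using assms by (intro hom.S.finsum_cong') (simp_all add: hom.hom_nat_pow Pi_iff)
  also have "\<dots> = I +> (\<Oplus>a\<in>A. \<theta> a [^] m)"
    using assms by (simp add: comp_def Pi_iff)
  also have "\<dots> = \<zero>\<^bsub>R Quot I\<^esub> \<longleftrightarrow> (\<Oplus>a\<in>A. \<theta> a [^] m) \<in> I"
    using rcos_const_imp_mem[OF power_sum_closed] a_rcos_zero[OF ideal_axioms]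
    unfolding FactRing_def ring_record_simps by blast
  finally show ?thesis .
qed

definition narrow_word :: "nat \<Rightarrow> letter list \<Rightarrow> bool" where
  "narrow_word N u \<longleftrightarrow> (\<forall>(i, j)\<in>set u. \<bar>i - j\<bar> < int N)"

lemma narrow_word_append [simp]: "narrow_word N (u @ v) \<longleftrightarrow> narrow_word N u \<and> narrow_word N v"
  by (auto simp: narrow_word_def)

lemma width_filt_iff: "f \<in> width_filt N \<longleftrightarrow> (\<forall>u. narrow_word N u \<longrightarrow> f u = 0)"
proof -
  have "narrow_word N u \<longleftrightarrow> \<not> (\<exists>(i, j)\<in>set u. int N \<le> \<bar>i - j\<bar>)" for u
    by (auto simp: narrow_word_def case_prod_beta not_le)
  then show ?thesis unfolding width_filt_def by blast
qed

lemma width_filt_mult: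
  assumes "f \<in> width_filt N \<or> g \<in> width_filt N"
  shows "ser_mult f g \<in> width_filt N"
  unfolding width_filt_iff
proof (intro allI impI, rule ccontr)
  fix u assume "narrow_word N u" "ser_mult f g u \<noteq> 0"
  then show False using assms by (auto simp: width_filt_iff elim!: ser_mult_nonzero)
qed

lemma br_wide: "int N \<le> \<bar>i - j\<bar> \<Longrightarrow> br i j \<in> width_filt N"
  unfolding width_filt_def
  by (auto dest!: br_nonzero simp: min_def max_def abs_minus_commute)

lemma ideal_width_filt:
  assumes "n \<ge> 2"
  shows "ideal (finite_action n \<inter> width_filt N) (E_alg n :: 'k::comm_ring_1 series ring)"
proof -
  interpret ring "E_alg n :: 'k series ring" by (rule ring_E_alg[OF assms])
  show ?thesis
  proof (rule idealI[OF ring_axioms], rule add.subgroupI)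
    show "finite_action n \<inter> width_filt N \<noteq> ({} :: 'k series set)"
      using finite_action_zero by (force simp: width_filt_iff)
    fix f g :: "'k series"
    assume f: "f \<in> finite_action n \<inter> width_filt N"
    show "\<ominus>\<^bsub>E_alg n\<^esub> f \<in> finite_action n \<inter> width_filt N"
      using f E_alg_a_inv[OF assms, of f] a_inv_closed[of f]
      by (simp add: width_filt_iff)
    show "f \<oplus>\<^bsub>E_alg n\<^esub> g \<in> finite_action n \<inter> width_filt N"
      if "g \<in> finite_action n \<inter> width_filt N"
      using f that by (simp add: finite_action_add width_filt_iff)
    show "g \<otimes>\<^bsub>E_alg n\<^esub> f \<in> finite_action n \<inter> width_filt N"
      "f \<otimes>\<^bsub>E_alg n\<^esub> g \<in> finite_action n \<inter> width_filt N" if "g \<in> carrier (E_alg n)"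
      using f that assms by (simp_all add: finite_action_mult width_filt_mult)
  qed simp
qed

definition truncated_ideal :: "triangle_form \<Rightarrow> nat \<Rightarrow> nat \<Rightarrow> 'k::comm_ring_1 series set" where
  "truncated_ideal c n N =
    Idl\<^bsub>E_alg n\<^esub> (relators c n) <+>\<^bsub>E_alg n\<^esub> (finite_action n \<inter> width_filt N)"

definition truncated_ring ::
  "triangle_form \<Rightarrow> nat \<Rightarrow> nat \<Rightarrow> 'k::comm_ring_1 series set ring" where
  "truncated_ring c n N = E_alg n Quot truncated_ideal c n N"

definition truncation ::
  "triangle_form \<Rightarrow> nat \<Rightarrow> nat \<Rightarrow> 'k::comm_ring_1 series \<Rightarrow> 'k series set" where
  "truncation c n N f = truncated_ideal c n N +>\<^bsub>E_alg n\<^esub> f"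

text \<open>The value \<open>0\<close> for congruent indices, where \<open>[ij]\<close> is not a symbol, avoids side conditions in
  the locale \<open>affine_FK_ring\<close>.\<close>

definition truncated_br ::
  "triangle_form \<Rightarrow> nat \<Rightarrow> nat \<Rightarrow> int \<Rightarrow> int \<Rightarrow> 'k::comm_ring_1 series set" where
  "truncated_br c n N i j =
    (if distinct_residues n [i, j] then truncation c n N (br i j) else \<zero>\<^bsub>truncated_ring c n N\<^esub>)"

context
  fixes c :: triangle_form and n :: nat
  assumes n_ge_2: "n \<ge> 2"
begin

interpretation E: ring "E_alg n :: 'k::comm_ring_1 series ring"
  by (rule ring_E_alg[OF n_ge_2])

interpretation Idl: ideal "Idl\<^bsub>E_alg n\<^esub> (relators c n)" "E_alg n :: 'k::comm_ring_1 series ring"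
  using relators_finite_action[OF n_ge_2] by (intro E.genideal_ideal) simp

lemma ideal_truncated_ideal:
  "ideal (truncated_ideal c n N) (E_alg n :: 'k::comm_ring_1 series ring)"
  unfolding truncated_ideal_def by (intro E.add_ideals Idl.is_ideal ideal_width_filt n_ge_2)

lemma truncated_ideal_iff:
  fixes f :: "'k::comm_ring_1 series"
  shows "f \<in> truncated_ideal c n N \<longleftrightarrow>
    f \<in> finite_action n \<and> (\<exists>g\<in>Idl\<^bsub>E_alg n\<^esub> (relators c n). ser_diff f g \<in> width_filt N)"
    (is "_ \<longleftrightarrow> ?approximable")
proof
  have Idl_subset: "Idl\<^bsub>E_alg n\<^esub> (relators c n) \<subseteq> (finite_action n :: 'k series set)"
    using Idl.a_subset by simp
  show ?approximable if f: "f \<in> truncated_ideal c n N"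
  proof -
    obtain g h where g: "g \<in> Idl\<^bsub>E_alg n\<^esub> (relators c n)" and h: "h \<in> finite_action n \<inter> width_filt N"
      and f_eq: "f = ser_add g h"
      using f by (auto simp: truncated_ideal_def set_add_def')
    moreover have "ser_diff f g = h"
      by (simp add: f_eq)
    ultimately show ?thesis
      using Idl_subset by (auto intro: finite_action_add intro!: bexI[of _ g])
  qed
  show "f \<in> truncated_ideal c n N" if f: ?approximable
  proof -
    obtain g where g: "g \<in> Idl\<^bsub>E_alg n\<^esub> (relators c n)" "ser_diff f g \<in> width_filt N"
      using f by blast
    then have "ser_diff f g \<in> finite_action n \<inter> width_filt N"
      using f Idl_subset by (auto intro: finite_action_diff)
    then show ?thesis
      using g(1) unfolding truncated_ideal_def set_add_def' E_alg_simps
      by (intro UN_I[of g] UN_I[of "ser_diff f g"]) simp_all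
  qed
qed

lemma relation_ideal_eq:
  "relation_ideal c n = (\<Inter>N. truncated_ideal c n N :: 'k::comm_ring_1 series set)"
  by (auto simp: relation_ideal_def truncated_ideal_iff)

lemma ideal_relation_ideal: "ideal (relation_ideal c n) (E_alg n :: 'k::comm_ring_1 series ring)"
  unfolding relation_ideal_eq by (rule E.i_Intersect) (auto intro: ideal_truncated_ideal)

context
  fixes N :: nat
begin

interpretation hom: ring_hom_ring
  "E_alg n :: 'k::comm_ring_1 series ring" "truncated_ring c n N" "truncation c n N"
  using ideal.rcos_ring_hom_ring[OF ideal_truncated_ideal]
  by (simp add: truncated_ring_def truncation_def[abs_def])

lemma truncation_eqI:
  fixes f g :: "'k::comm_ring_1 series"
  assumes "f \<in> finite_action n" "g \<in> finite_action n"
    and diff: "ser_diff f g \<in> relators c n \<union> width_filt N"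
  shows "truncation c n N f = truncation c n N g"
proof -
  have "relators c n \<subseteq> Idl\<^bsub>E_alg n\<^esub> (relators c n :: 'k series set)"
    using relators_finite_action[OF n_ge_2] by (intro E.genideal_self) simp
  moreover have "(\<lambda>_. 0) \<in> Idl\<^bsub>E_alg n\<^esub> (relators c n :: 'k series set)"
    using Idl.zero_closed by simp
  moreover have "(\<lambda>_. 0) \<in> (width_filt N :: 'k series set)"
    by (simp add: width_filt_iff)
  ultimately have "\<exists>h\<in>Idl\<^bsub>E_alg n\<^esub> (relators c n). ser_diff (ser_diff f g) h \<in> width_filt N"
    using diff by (elim UnE; force)
  then have "f \<ominus>\<^bsub>E_alg n\<^esub> g \<in> truncated_ideal c n N"
    using assms(1,2) by (simp add: E_alg_minus[OF n_ge_2] truncated_ideal_iff finite_action_diff)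
  then show ?thesis
    using E.quotient_eq_iff_same_a_r_cos[OF ideal_truncated_ideal, of f g] assms(1,2)
    by (simp add: truncation_def)
qed

lemma truncation_eq_zeroI:
  fixes f :: "'k::comm_ring_1 series"
  assumes "f \<in> finite_action n" "f \<in> relators c n \<union> width_filt N"
  shows "truncation c n N f = \<zero>\<^bsub>truncated_ring c n N\<^esub>"
proof -
  have "truncation c n N f = truncation c n N (\<lambda>_. 0)"
    using assms by (intro truncation_eqI finite_action_zero) simp_all
  then show ?thesis using hom.hom_zero by simp
qed

lemma truncation_ser_sum:
  fixes F :: "'b \<Rightarrow> 'k::comm_ring_1 series"
  assumes "finite A" "A \<subseteq> I" and wide: "\<And>a. a \<in> I - A \<Longrightarrow> F a \<in> width_filt N"
    and F: "F \<in> A \<rightarrow> finite_action n" and "ser_sum I F \<in> finite_action n"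
  shows "truncation c n N (ser_sum I F) =
    (\<Oplus>\<^bsub>truncated_ring c n N\<^esub>a\<in>A. truncation c n N (F a))"
proof -
  have "ser_sum I F u = (\<Oplus>\<^bsub>E_alg n\<^esub>a\<in>A. F a) u" if "narrow_word N u" for u
    unfolding finsum_E_alg[OF n_ge_2 assms(1) F]
    using that assms(1,2) wide by (intro ser_sum_eq_sum) (auto simp: width_filt_iff)
  then have "ser_diff (ser_sum I F) (\<Oplus>\<^bsub>E_alg n\<^esub>a\<in>A. F a) \<in> width_filt N"
    by (simp add: width_filt_iff)
  then have "truncation c n N (ser_sum I F) = truncation c n N (\<Oplus>\<^bsub>E_alg n\<^esub>a\<in>A. F a)"
    using assms E.finsum_closed[of F A] by (intro truncation_eqI) simp_all
  also have "\<dots> = (\<Oplus>\<^bsub>truncated_ring c n N\<^esub>a\<in>A. truncation c n N (F a))"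
    using F by (simp add: comp_def)
  finally show ?thesis .
qed

lemma truncated_br_closed [simp]:
  "truncated_br c n N i j \<in> carrier (truncated_ring c n N :: 'k::comm_ring_1 series set ring)"
  by (simp add: truncated_br_def finite_action_br[OF n_ge_2])

lemma truncation_ser_mult_br:
  assumes "distinct_residues n [i, j]" "distinct_residues n [k, l]"
  shows "truncation c n N (ser_mult (br i j) (br k l) :: 'k::comm_ring_1 series) =
    truncated_br c n N i j \<otimes>\<^bsub>truncated_ring c n N\<^esub> truncated_br c n N k l"
  using assms hom.hom_mult[of "br i j" "br k l"]
  by (simp add: truncated_br_def finite_action_br[OF n_ge_2])

lemma truncated_br_anti:
  "truncated_br c n N j i =
    \<ominus>\<^bsub>truncated_ring c n N :: 'k::comm_ring_1 series set ring\<^esub> truncated_br c n N i j"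
proof (cases "distinct_residues n [i, j]")
  case True
  then have "i \<noteq> j"
    by (auto simp: distinct_residues_def)
  with True have "\<ominus>\<^bsub>E_alg n\<^esub> br i j = (br j i :: 'k series)"
    by (simp add: E_alg_a_inv[OF n_ge_2] finite_action_br[OF n_ge_2] br_swap[of i j])
  then show ?thesis
    using True hom.hom_a_inv[of "br i j :: 'k series"]
    by (simp add: truncated_br_def finite_action_br[OF n_ge_2] distinct_residues_def)
qed (auto simp: truncated_br_def distinct_residues_def)

lemma truncated_br_shift:
  "truncated_br c n N (i + int n) (j + int n) =
    (truncated_br c n N i j :: 'k::comm_ring_1 series set)"
proof (cases "distinct_residues n [i, j]")
  case True
  then have "truncation c n N (br i j :: 'k series) = truncation c n N (br (i + int n) (j + int n))"
    using relators.shift[OF True, of c]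
    by (intro truncation_eqI finite_action_br n_ge_2) (auto simp: distinct_residues_def)
  then show ?thesis
    using True by (simp add: truncated_br_def distinct_residues_def)
qed (simp add: truncated_br_def distinct_residues_def)

lemma truncated_br_wide:
  assumes "int N \<le> \<bar>i - j\<bar>"
  shows "truncated_br c n N i j = \<zero>\<^bsub>truncated_ring c n N :: 'k::comm_ring_1 series set ring\<^esub>"
proof (cases "distinct_residues n [i, j]")
  case True
  then have "truncation c n N (br i j :: 'k series) = \<zero>\<^bsub>truncated_ring c n N\<^esub>"
    by (intro truncation_eq_zeroI UnI2 finite_action_br br_wide assms n_ge_2)
  then show ?thesis
    using True by (simp add: truncated_br_def)
qed (simp add: truncated_br_def)

lemma truncated_br_commute:
  defines "Q \<equiv> truncated_ring c n N :: 'k::comm_ring_1 series set ring"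
    and "b \<equiv> truncated_br c n N"
  assumes distinct: "distinct_residues n [i, j, k, l]"
  shows "b i j \<otimes>\<^bsub>Q\<^esub> b k l = b k l \<otimes>\<^bsub>Q\<^esub> b i j"
proof -
  have pairs: "distinct_residues n [i, j]" "distinct_residues n [k, l]"
    using distinct by (auto simp: distinct_residues_def)
  then have "truncation c n N (ser_mult (br i j) (br k l) :: 'k series) =
      truncation c n N (ser_mult (br k l) (br i j))"
    using relators.commute[OF distinct, of c]
    by (intro truncation_eqI finite_action_mult finite_action_br n_ge_2) auto
  then show ?thesis
    by (simp add: b_def Q_def truncation_ser_mult_br pairs)
qed

lemma truncated_br_triangle:
  defines "Q \<equiv> truncated_ring c n N :: 'k::comm_ring_1 series set ring"
    and "b \<equiv> truncated_br c n N"
  assumes distinct: "distinct_residues n [i, j, k]"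
  shows "b i j \<otimes>\<^bsub>Q\<^esub> b j k = b j k \<otimes>\<^bsub>Q\<^esub> b i k \<oplus>\<^bsub>Q\<^esub> b i k \<otimes>\<^bsub>Q\<^esub> b i j"
proof -
  let ?jk_ik = "ser_mult (br j k) (br i k) :: 'k series" and ?ik_ij = "ser_mult (br i k) (br i j)"
  have pairs: "distinct_residues n [i, j]" "distinct_residues n [j, k]" "distinct_residues n [i, k]"
    using distinct by (auto simp: distinct_residues_def)
  then have "truncation c n N (ser_mult (br i j) (br j k) :: 'k series) =
      truncation c n N (ser_add ?jk_ik ?ik_ij)"
    using relators.triangle1[OF distinct, of c]
    by (intro truncation_eqI finite_action_add finite_action_mult finite_action_br n_ge_2) auto
  also have "\<dots> = truncation c n N ?jk_ik \<oplus>\<^bsub>Q\<^esub> truncation c n N ?ik_ij"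
    using hom.hom_add[of ?jk_ik ?ik_ij] pairs
    by (simp add: Q_def finite_action_mult finite_action_br n_ge_2)
  finally show ?thesis
    by (simp add: b_def Q_def truncation_ser_mult_br pairs)
qed

lemma truncation_residue_sum:
  defines "Q \<equiv> truncated_ring c n N :: 'k::comm_ring_1 series set ring"
    and "b \<equiv> truncated_br c n N"
  assumes distinct: "distinct_residues n [i, j]"
  shows "truncation c n N
      (ser_sum {(i', j'). i' mod int n = i mod int n \<and> j' mod int n = j mod int n}
        (\<lambda>(i', j'). ser_mult (br i j') (br j i'))) =
    finsum Q (\<lambda>(i', j'). b i j' \<otimes>\<^bsub>Q\<^esub> b j i') (residue_window n N j i \<times> residue_window n N i j)"
    (is "truncation c n N (ser_sum ?I ?F) = finsum Q ?f ?W")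
proof -
  have pairs: "distinct_residues n [i, j']" "distinct_residues n [j, i']"
    if "(i', j') \<in> ?I" for i' j'
    using that distinct by (auto simp: distinct_residues_def)
  have windows_subset: "?W \<subseteq> ?I"
    by (auto simp: residue_window_def)
  have "truncation c n N (ser_sum ?I ?F) = finsum Q (\<lambda>p. truncation c n N (?F p)) ?W"
    unfolding Q_def
  proof (rule truncation_ser_sum)
    show "?F p \<in> width_filt N" if "p \<in> ?I - ?W" for p
      using that
      by (auto simp: residue_window_def abs_minus_commute intro!: width_filt_mult br_wide)
    show "?F \<in> ?W \<rightarrow> finite_action n"
      using windows_subset pairs by (auto intro!: finite_action_mult finite_action_br n_ge_2)
    show "ser_sum ?I ?F \<in> finite_action n"
      by (rule finite_action_residue_sum[OF n_ge_2 distinct])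
  qed (use windows_subset in simp_all)
  also have "\<dots> = finsum Q ?f ?W"
  proof (unfold Q_def b_def, intro hom.S.finsum_cong' refl)
    fix p assume "p \<in> ?W"
    then show "truncation c n N (?F p) = (case p of (i', j') \<Rightarrow>
        truncated_br c n N i j' \<otimes>\<^bsub>truncated_ring c n N\<^esub> truncated_br c n N j i')"
      using windows_subset pairs by (auto simp: truncation_ser_mult_br)
  qed auto
  finally show ?thesis .
qed

lemma truncated_br_residue:
  defines "Q \<equiv> truncated_ring c n N :: 'k::comm_ring_1 series set ring"
    and "b \<equiv> truncated_br c n N"
  assumes distinct: "distinct_residues n [i, j]"
  shows "(\<Oplus>\<^bsub>Q\<^esub>j'\<in>residue_window n N i j. b i j') \<otimes>\<^bsub>Q\<^esub> (\<Oplus>\<^bsub>Q\<^esub>i'\<in>residue_window n N j i. b j i') = \<zero>\<^bsub>Q\<^esub>"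
proof -
  interpret ring Q
    unfolding Q_def by (rule hom.S.ring_axioms)
  have b_closed [simp]: "b k l \<in> carrier Q" for k l
    by (simp add: b_def Q_def)
  let ?A = "residue_window n N j i" and ?B = "residue_window n N i j"
  have "(\<Oplus>\<^bsub>Q\<^esub>j'\<in>?B. b i j') \<otimes>\<^bsub>Q\<^esub> (\<Oplus>\<^bsub>Q\<^esub>i'\<in>?A. b j i') =
      (\<Oplus>\<^bsub>Q\<^esub>j'\<in>?B. \<Oplus>\<^bsub>Q\<^esub>i'\<in>?A. b i j' \<otimes>\<^bsub>Q\<^esub> b j i')"
    by (simp add: finsum_product)
  also have "\<dots> = (\<Oplus>\<^bsub>Q\<^esub>i'\<in>?A. \<Oplus>\<^bsub>Q\<^esub>j'\<in>?B. b i j' \<otimes>\<^bsub>Q\<^esub> b j i')"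
    by (rule finsum_swap) simp_all
  also have "\<dots> = finsum Q (\<lambda>(i', j'). b i j' \<otimes>\<^bsub>Q\<^esub> b j i') (?A \<times> ?B)"
    by (rule finsum_Sigma) simp_all
  also have "\<dots> = \<zero>\<^bsub>Q\<^esub>"
    unfolding Q_def b_def truncation_residue_sum[OF distinct, symmetric]
    by (intro truncation_eq_zeroI UnI1 relators.residue_sum finite_action_residue_sum
        n_ge_2 distinct)
  finally show ?thesis .
qed

lemma affine_FK_ring_truncated:
  "affine_FK_ring (truncated_ring c n N :: 'k::comm_ring_1 series set ring) n N
    (truncated_br c n N)"
  by (intro affine_FK_ring.intro affine_FK_ring_axioms.intro hom.S.ring_axioms truncated_br_closed
      truncated_br_anti truncated_br_shift truncated_br_wide truncated_br_commute
      truncated_br_triangle truncated_br_residue) (use n_ge_2 in simp_all)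

lemma truncation_dunkl:
  "truncation c n N (dunkl n i :: 'k::comm_ring_1 series) =
    (\<Oplus>\<^bsub>truncated_ring c n N\<^esub>j\<in>{j. distinct_residues n [i, j] \<and> \<bar>j - i\<bar> < int N}.
      truncated_br c n N i j)"
proof -
  let ?A = "{j. distinct_residues n [i, j] \<and> \<bar>j - i\<bar> < int N}"
  have "truncation c n N (dunkl n i :: 'k series) =
      (\<Oplus>\<^bsub>truncated_ring c n N\<^esub>j\<in>?A. truncation c n N (br i j))"
    unfolding dunkl_def
  proof (rule truncation_ser_sum)
    show "finite ?A"
      by (rule finite_subset[of _ "{i - int N..i + int N}"]) auto
    show "ser_sum {j. distinct_residues n [i, j]} (br i) \<in> (finite_action n :: 'k series set)"
      using finite_action_dunkl[OF n_ge_2] by (simp add: dunkl_def)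
  qed (auto simp: finite_action_br n_ge_2 abs_minus_commute intro: br_wide)
  also have "\<dots> = (\<Oplus>\<^bsub>truncated_ring c n N\<^esub>j\<in>?A. truncated_br c n N i j)"
    by (intro hom.S.finsum_cong' refl Pi_I truncated_br_closed) (simp add: truncated_br_def)
  finally show ?thesis .
qed

lemma dunkl_power_sum_truncated_ideal:
  fixes m :: nat
  assumes "m \<ge> 1"
  shows "(\<Oplus>\<^bsub>E_alg n\<^esub>i\<in>{1..int n}. dunkl n i [^]\<^bsub>E_alg n\<^esub> m) \<in>
    (truncated_ideal c n N :: 'k::comm_ring_1 series set)"
proof -
  have "(\<Oplus>\<^bsub>truncated_ring c n N\<^esub>i\<in>{1..int n}.
      truncation c n N (dunkl n i) [^]\<^bsub>truncated_ring c n N\<^esub> m) =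
      \<zero>\<^bsub>(truncated_ring c n N :: 'k series set ring)\<^esub>"
    unfolding truncation_dunkl
    using affine_FK_ring_truncated assms by (rule affine_FK_ring.affine_dunkl_power_sum)
  then show ?thesis
    unfolding truncated_ring_def truncation_def
    by (subst (asm) ideal.rcos_power_sum_eq_zero_iff[OF ideal_truncated_ideal])
      (simp_all add: finite_action_dunkl n_ge_2)
qed

end

end

theorem theorem4p10:
  fixes n m :: nat and c :: triangle_form
  assumes "n \<ge> 2" and "m \<ge> 1"
  shows "(\<Oplus>\<^bsub>affine_FK c n\<^esub> i \<in> {1..int n}. FK_dunkl c n i [^]\<^bsub>affine_FK c n\<^esub> m)
           = \<zero>\<^bsub>(affine_FK c n :: 'k::comm_ring_1 series set ring)\<^esub>"
proof -
  have "(\<Oplus>\<^bsub>E_alg n\<^esub>i\<in>{1..int n}. dunkl n i [^]\<^bsub>E_alg n\<^esub> m) \<in> (relation_ideal c n :: 'k series set)"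
    using assms by (simp add: relation_ideal_eq dunkl_power_sum_truncated_ideal)
  moreover have "dunkl n \<in> {1..int n} \<rightarrow> carrier (E_alg n :: 'k series ring)"
    using assms by (simp add: finite_action_dunkl)
  ultimately show ?thesis
    unfolding affine_FK_def FK_dunkl_def
    by (simp only: ideal.rcos_power_sum_eq_zero_iff[OF ideal_relation_ideal[OF assms(1)]])
qed

end
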